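(* Let $n\ge2$, $0<m<n$, and let $f:\mathbb{R}^n\to\mathbb{R}^m$ be smooth with Jacobian $J(x)$ of full rank $m$ for every $x\in\mathbb{R}^n$. With $T$, $N$, $N'_\perp$, $N'_\|$ as in the context, consider the system of ODEs in $\mathbb{R}^n\times\mathbb{R}^n$ $$\frac{d}{dt}x=T(x)v,\qquad \frac{d}{dt}v=\Bigl(N'_\|(x)\bigl[(T(x)-N(x))v\bigr]-N'_\perp(x)\bigl[(T(x)-N(x))v\bigr]\Bigr)v.$$ This system has the following properties: 1. It preserves volume in $\mathbb{R}^n\times\mathbb{R}^n$. 2. It is time-reversible, i.e. it remains invariant after changing $t$ into $-t$ and $v$ into $-v$. 3. It conserves the Euclidean length of $v(t)$: $\frac{d}{dt}\|v(t)\|^2=0$ along solutions. 4. $x(t)$ remains on the level set $\{y\in\mathbb{R}^n: f(y)=f(x(0))\}$: $\frac{d}{dt}f(x(t))=0$ along solutions.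
   Context: $J(x)$ is the $m\times n$ Jacobian of $f$ at $x$; $J(x)^+=J(x)^\top(J(x)J(x)^\top)^{-1}$; $N(x)=J(x)^+J(x)$ is the orthogonal projection onto the orthogonal complement of $\ker J(x)$; $T(x)=I-N(x)$ is the orthogonal projection onto $\ker J(x)$. $H(x):\mathbb{R}^n\times\mathbb{R}^n\to\mathbb{R}^m$ is the second derivative of $f$ at $x$ (the $i$-th component of $H(x)[u,w]$ is $u^\top\nabla^2f_i(x)w$), and $H(x)[w,\cdot]$ is the $m\times n$ matrix of the linear map $z\mapsto H(x)[w,z]$. For $x,w\in\mathbb{R}^n$ define the $n\times n$ matrices $$N'_\perp(x)[w]=J(x)^+H(x)[w,\cdot]\,T(x),\qquad N'_\|(x)[w]=\bigl(N'_\perp(x)[w]\bigr)^\top.$$ (By a result of Golub and Pereyra, the derivative $N'(x)[w]$ of $N$ at $x$ in the direction $w$ equals $N'_\perp(x)[w]+N'_\|(x)[w]$.) "Preserves volume" means that the flow of the system preserves Lebesgue measure, equivalently that the vector field is divergence free. *)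

theory Defs
  imports "HOL-Analysis.Analysis"
begin

text \<open>For a map that is differentiable everywhere on a finite-dimensional space, its derivative is
  \<open>C\<^sup>k\<close> iff all directional derivatives are; this gives the recursion below.\<close>

fun C_k :: "nat \<Rightarrow> ('a::euclidean_space \<Rightarrow> 'b::real_normed_vector) \<Rightarrow> bool" where
  "C_k 0 f \<longleftrightarrow> continuous_on UNIV f"
| "C_k (Suc k) f \<longleftrightarrow>
     f differentiable_on UNIV \<and> (\<forall>u. C_k k (\<lambda>x. frechet_derivative f (at x) u))"

definition smooth :: "('a::euclidean_space \<Rightarrow> 'b::real_normed_vector) \<Rightarrow> bool" where
  "smooth f \<longleftrightarrow> (\<forall>k. C_k k f)"

abbreviation Jac :: "(real^'n \<Rightarrow> real^'m) \<Rightarrow> real^'n \<Rightarrow> real^'n^'m" where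
  "Jac f x \<equiv> jacobian f (at x)"

text \<open>Junk unless \<open>Jac f x\<close> has full row rank.\<close>

definition Jplus :: "(real^'n \<Rightarrow> real^'m) \<Rightarrow> real^'n \<Rightarrow> real^'m^'n" where
  "Jplus f x = transpose (Jac f x) ** matrix_inv (Jac f x ** transpose (Jac f x))"

definition Nproj :: "(real^'n \<Rightarrow> real^'m) \<Rightarrow> real^'n \<Rightarrow> real^'n^'n" where
  "Nproj f x = Jplus f x ** Jac f x"

definition Tproj :: "(real^'n \<Rightarrow> real^'m) \<Rightarrow> real^'n \<Rightarrow> real^'n^'n" where
  "Tproj f x = mat 1 - Nproj f x"

definition hessian :: "(real^'n \<Rightarrow> real) \<Rightarrow> real^'n \<Rightarrow> real^'n^'n" where
  "hessian g x = (\<chi> j k. frechet_derivative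
     (\<lambda>y. frechet_derivative g (at y) (axis k 1)) (at x) (axis j 1))"

definition H :: "(real^'n \<Rightarrow> real^'m) \<Rightarrow> real^'n \<Rightarrow> real^'n \<Rightarrow> real^'n \<Rightarrow> real^'m" where
  "H f x u w = (\<chi> i. u \<bullet> (hessian (\<lambda>y. f y $ i) x *v w))"

definition Nperp' :: "(real^'n \<Rightarrow> real^'m) \<Rightarrow> real^'n \<Rightarrow> real^'n \<Rightarrow> real^'n^'n" where
  "Nperp' f x w = Jplus f x ** matrix (H f x w) ** Tproj f x"

definition Npar' :: "(real^'n \<Rightarrow> real^'m) \<Rightarrow> real^'n \<Rightarrow> real^'n \<Rightarrow> real^'n^'n" where
  "Npar' f x w = transpose (Nperp' f x w)"

text \<open>The derivative is one-sided at endpoints of \<open>S\<close> that belong to \<open>S\<close>.\<close>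

definition solution ::
    "('a::real_normed_vector \<Rightarrow> 'a) \<Rightarrow> real set \<Rightarrow> (real \<Rightarrow> 'a) \<Rightarrow> bool" where
  "solution F S z \<longleftrightarrow>
     is_interval S \<and> (\<forall>t\<in>S. (z has_vector_derivative F (z t)) (at t within S))"

text \<open>Initial values whose solution exists up to time \<open>t\<close> (possibly negative), and the time-\<open>t\<close>
  flow map on them; it is meant for vector fields with unique solutions, e.g. \<open>C\<^sup>1\<close> ones.\<close>

definition flow_domain :: "('a::real_normed_vector \<Rightarrow> 'a) \<Rightarrow> real \<Rightarrow> 'a set" where
  "flow_domain F t = {a. \<exists>z. solution F (closed_segment 0 t) z \<and> z 0 = a}"

definition flow :: "('a::real_normed_vector \<Rightarrow> 'a) \<Rightarrow> real \<Rightarrow> 'a \<Rightarrow> 'a" where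
  "flow F t a = (THE b. \<exists>z. solution F (closed_segment 0 t) z \<and> z 0 = a \<and> z t = b)"

definition flow_preserves_lebesgue :: "('a::euclidean_space \<Rightarrow> 'a) \<Rightarrow> bool" where
  "flow_preserves_lebesgue F \<longleftrightarrow>
     (\<forall>t A. A \<in> sets lebesgue \<and> A \<subseteq> flow_domain F t \<longrightarrow>
        flow F t ` A \<in> sets lebesgue \<and>
        emeasure lebesgue (flow F t ` A) = emeasure lebesgue A)"

definition divergence :: "('a::euclidean_space \<Rightarrow> 'a) \<Rightarrow> 'a \<Rightarrow> real" where
  "divergence F x = (\<Sum>b\<in>Basis. frechet_derivative F (at x) b \<bullet> b)"

definition divergence_free :: "('a::euclidean_space \<Rightarrow> 'a) \<Rightarrow> bool" where
  "divergence_free F \<longleftrightarrow> F differentiable_on UNIV \<and> (\<forall>x. divergence F x = 0)"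

text \<open>Substituting \<open>t \<mapsto> -t\<close>, \<open>z \<mapsto> R z\<close> maps solutions to solutions.\<close>

definition time_reversible ::
    "('a::real_normed_vector \<Rightarrow> 'a) \<Rightarrow> ('a \<Rightarrow> 'a) \<Rightarrow> bool" where
  "time_reversible R F \<longleftrightarrow>
     (\<forall>S z. solution F S z \<longleftrightarrow> solution F (uminus ` S) (\<lambda>t. R (z (- t))))"

definition ode_field ::
    "(real^'n \<Rightarrow> real^'m) \<Rightarrow> (real^'n) \<times> (real^'n) \<Rightarrow> (real^'n) \<times> (real^'n)" where
  "ode_field f = (\<lambda>(x, v).
     let w = (Tproj f x - Nproj f x) *v v
     in (Tproj f x *v v, (Npar' f x w - Nperp' f x w) *v v))"

end

theory Submission
  imports Defs
begin

text \<open>Liouville's theorem is obtained without differentiating the flow. For a divergence-free field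
  \<open>G\<close> the Euler map \<open>x \<mapsto> x + h G x\<close> is injective on balls and its Jacobian determinant is
  \<open>1 + O(h\<^sup>2)\<close>. Composing \<open>n\<close> Euler maps with step \<open>1/n\<close> therefore shrinks the measure of a compact
  set \<open>K\<close> by a factor \<open>1 - O(1/n)\<close> at worst, while the composition converges uniformly on \<open>K\<close> to the
  time-one map \<open>P\<close>; by outer regularity the measure of \<open>P K\<close> is at least that of \<open>K\<close>. Reversing time
  gives the opposite inequality, and as \<open>P\<close> is locally Lipschitz, sigma-compact sets and null
  sets yield all Lebesgue sets.

  With \<open>S = T - N\<close>, the \<open>x\<close>-part of the divergence is \<open>- \<alpha> - \<beta>\<close> by the Golub--Pereyra formula, where
  \<open>\<alpha>\<close> and \<open>\<beta>\<close> sum \<open>b \<bullet> J\<^sup>+ H[b, T v]\<close> and \<open>J\<^sup>+ H[b, T b] \<bullet> v\<close> over an orthonormal basis. The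
  \<open>v\<close>-part is \<open>\<alpha> + \<beta>\<close>, because \<open>S\<close> is symmetric with \<open>T S = T\<close> and \<open>S J\<^sup>+ = - J\<^sup>+\<close>. The matrix
  acting on \<open>v\<close> is skew and \<open>J T = 0\<close>, which gives the conservation laws, and these confine
  trajectories to bounded sets.\<close>

section \<open>Volume distortion of near-identity maps\<close>

text \<open>Adding an index \<open>j\<close> changes the remainder by
  \<open>h * a j * (P - 1)\<close>, and \<open>P - 1\<close> is itself \<open>O(h)\<close>, so the
  remainder stays quadratic. The constant depends on \<open>I\<close> and \<open>B\<close> only, not
  on the \<open>a i\<close>, which makes the bound uniform over all points of a set.\<close>

lemma prod_one_plus_small:
  fixes B :: real
  assumes "finite I" and "0 \<le> B"
  shows "\<exists>C\<ge>0. \<forall>a h. (\<forall>i\<in>I. \<bar>a i\<bar> \<le> B) \<and> \<bar>h\<bar> \<le> 1 \<longrightarrow>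
           \<bar>(\<Prod>i\<in>I. 1 + h * a i) - 1 - h * (\<Sum>i\<in>I. a i)\<bar> \<le> C * h\<^sup>2"
  using assms(1)
proof (induction I)
  case empty
  then show ?case by (auto intro!: exI[of _ 0])
next
  case (insert j I)
  then obtain C where C: "C \<ge> 0" "\<And>a h. (\<forall>i\<in>I. \<bar>a i\<bar> \<le> B) \<Longrightarrow> \<bar>h\<bar> \<le> 1 \<Longrightarrow>
      \<bar>(\<Prod>i\<in>I. 1 + h * a i) - 1 - h * (\<Sum>i\<in>I. a i)\<bar> \<le> C * h\<^sup>2" by metis
  let ?D = "C + B * (C + card I * B)"
  have "\<bar>(\<Prod>i\<in>insert j I. 1 + h * a i) - 1 - h * (\<Sum>i\<in>insert j I. a i)\<bar> \<le> ?D * h\<^sup>2"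
    if a: "\<forall>i\<in>insert j I. \<bar>a i\<bar> \<le> B" and h: "\<bar>h\<bar> \<le> 1" for a h
  proof -
    define P where "P = (\<Prod>i\<in>I. 1 + h * a i)"
    define Q where "Q = (\<Sum>i\<in>I. a i)"
    have 1: "\<bar>P - 1 - h * Q\<bar> \<le> C * h\<^sup>2" unfolding P_def Q_def using C(2) a h by auto
    have Q: "\<bar>Q\<bar> \<le> card I * B"
      unfolding Q_def using a
      by (intro order_trans[OF sum_abs] sum_bounded_above) auto
    have h2: "h\<^sup>2 \<le> \<bar>h\<bar>" using h by (metis abs_ge_zero abs_power2 power2_eq_square mult_left_le abs_mult)
    have "\<bar>P - 1\<bar> \<le> \<bar>P - 1 - h * Q\<bar> + \<bar>h * Q\<bar>" by linarith
    also have "\<dots> \<le> C * \<bar>h\<bar> + \<bar>h\<bar> * (card I * B)"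
      using 1 mult_left_mono[OF h2 C(1)] mult_left_mono[OF Q abs_ge_zero[of h]] by (simp add: abs_mult)
    finally have 2: "\<bar>P - 1\<bar> \<le> \<bar>h\<bar> * (C + card I * B)" by (simp add: algebra_simps)
    have "\<bar>h * a j * (P - 1)\<bar> \<le> \<bar>h\<bar> * B * (\<bar>h\<bar> * (C + card I * B))"
      using a 2 assms(2) unfolding abs_mult by (intro mult_mono) auto
    also have "\<dots> = B * (C + card I * B) * h\<^sup>2"
      using abs_mult_self_eq[of h] by (simp add: power2_eq_square mult.assoc mult.left_commute)
    finally have 3: "\<bar>h * a j * (P - 1)\<bar> \<le> B * (C + card I * B) * h\<^sup>2" .
    have "(\<Prod>i\<in>insert j I. 1 + h * a i) - 1 - h * (\<Sum>i\<in>insert j I. a i)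
        = (P - 1 - h * Q) + h * a j * (P - 1)"
      using insert.hyps by (simp add: P_def Q_def algebra_simps)
    with 1 3 show ?thesis by (simp add: algebra_simps)
  qed
  moreover have "?D \<ge> 0" using C(1) assms(2) by simp
  ultimately show ?case by blast
qed

text \<open>In the Leibniz expansion the identity permutation contributes the diagonal product,
  whose linear term is the trace. Every other permutation moves at least two indices, so its term
  contains at least two off-diagonal entries, each of size \<open>O(h)\<close>.\<close>

lemma det_one_plus_small:
  fixes B :: real
  assumes "0 \<le> B"
  obtains C where "0 \<le> C" and "\<And>(A::real^'k^'k) h. (\<And>i j. \<bar>A$i$j\<bar> \<le> B) \<Longrightarrow> \<bar>h\<bar> \<le> 1 \<Longrightarrow>
           \<bar>det (mat 1 + h *\<^sub>R A) - 1 - h * trace A\<bar> \<le> C * h\<^sup>2"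
proof -
  obtain C where C: "C \<ge> 0" "\<And>a h. (\<forall>i\<in>(UNIV::'k set). \<bar>a i\<bar> \<le> B) \<Longrightarrow> \<bar>h\<bar> \<le> 1 \<Longrightarrow>
      \<bar>(\<Prod>i\<in>(UNIV::'k set). 1 + h * a i) - 1 - h * (\<Sum>i\<in>(UNIV::'k set). a i)\<bar> \<le> C * h\<^sup>2"
    using prod_one_plus_small[of "UNIV::'k set" B] assms by auto
  define N where "N = CARD('k)"
  let ?P = "{p. p permutes (UNIV::'k set)}"
  define D where "D = C + card ?P * (1 + B)^N"
  have "\<bar>det (mat 1 + h *\<^sub>R A) - 1 - h * trace A\<bar> \<le> D * h\<^sup>2"
    if A: "\<And>i j. \<bar>A$i$j\<bar> \<le> B" and h: "\<bar>h\<bar> \<le> 1" for A :: "real^'k^'k" and h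
  proof -
    let ?M = "mat 1 + h *\<^sub>R A"
    let ?f = "\<lambda>p. of_int (sign p) * (\<Prod>i\<in>UNIV. ?M$i$p i)"
    have fin: "finite ?P" by (simp add: finite_permutations)
    have idP: "id \<in> ?P" by (simp add: permutes_id)
    have "det ?M = ?f id + sum ?f (?P - {id})"
      unfolding det_def by (rule sum.remove[OF fin idP])
    moreover have "?f id = (\<Prod>i\<in>UNIV. 1 + h * A$i$i)"
      by (simp add: mat_def)
    moreover have "\<bar>sum ?f (?P - {id})\<bar> \<le> card ?P * (1 + B)^N * h\<^sup>2"
    proof -
      have le: "\<bar>?f p\<bar> \<le> (1 + B)^N * h\<^sup>2" if p: "p \<in> ?P - {id}" for p
      proof -
        let ?X = "{i. p i \<noteq> i}"
        have inj: "inj p" using p permutes_inj by blast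
        obtain i where i: "p i \<noteq> i" using p by (auto simp: fun_eq_iff)
        then have "p (p i) \<noteq> p i" using inj by (simp add: inj_eq)
        then have "{i, p i} \<subseteq> ?X" using i by auto
        then have "card {i, p i} \<le> card ?X" by (intro card_mono) auto
        then have c2: "2 \<le> card ?X" using i by simp
        have "\<bar>?f p\<bar> = (\<Prod>i\<in>UNIV. \<bar>?M$i$p i\<bar>)"
          by (simp add: abs_mult abs_prod sign_def)
        \<comment> \<open>A factor at a moved index is an off-diagonal entry, at most
          \<open>\<bar>h\<bar> * B\<close>; a factor at a fixed index is at most
          \<open>1 + B\<close>. The common bound leaves one power of \<open>\<bar>h\<bar>\<close>
          for each moved index.\<close>
        also have "\<dots> \<le> (\<Prod>i\<in>UNIV. (1 + B) * (if i \<in> ?X then \<bar>h\<bar> else 1))"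
        proof (intro prod_mono conjI)
          fix i
          have "\<bar>h * A$i$p i\<bar> \<le> \<bar>h\<bar> * B" using A by (simp add: abs_mult mult_left_mono)
          moreover have "\<bar>h\<bar> * B \<le> B" using h assms by (simp add: mult_left_le_one_le)
          ultimately show "\<bar>?M$i$p i\<bar> \<le> (1 + B) * (if i \<in> ?X then \<bar>h\<bar> else 1)"
            by (auto simp: mat_def algebra_simps)
        qed auto
        also have "\<dots> = (1 + B)^N * (\<Prod>i\<in>UNIV. if i \<in> ?X then \<bar>h\<bar> else 1)"
          by (simp only: prod.distrib prod_constant N_def)
        also have "(\<Prod>i\<in>UNIV. if i \<in> ?X then \<bar>h\<bar> else 1) = \<bar>h\<bar> ^ card ?X"
          by (subst prod.inter_filter[symmetric]) auto
        also have "\<bar>h\<bar> ^ card ?X \<le> \<bar>h\<bar>^2" using c2 h by (intro power_decreasing) auto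
        finally show ?thesis using assms by (simp add: mult_left_mono)
      qed
      have "\<bar>sum ?f (?P - {id})\<bar> \<le> (\<Sum>p\<in>?P - {id}. \<bar>?f p\<bar>)" by (rule sum_abs)
      also have "\<dots> \<le> card (?P - {id}) * ((1 + B)^N * h\<^sup>2)"
        using le by (rule sum_bounded_above)
      also have "\<dots> \<le> card ?P * ((1 + B)^N * h\<^sup>2)"
        using assms fin by (intro mult_right_mono) (auto intro!: card_mono)
      finally show ?thesis by (simp add: mult.assoc)
    qed
    moreover have "\<bar>(\<Prod>i\<in>UNIV. 1 + h * A$i$i) - 1 - h * trace A\<bar> \<le> C * h\<^sup>2"
      unfolding trace_def using A h by (intro C(2)) auto
    ultimately show ?thesis unfolding D_def by (simp add: algebra_simps)
  qed
  moreover have "D \<ge> 0" unfolding D_def using C(1) assms by simp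
  ultimately show thesis using that by blast
qed

text \<open>The measure of the image is the integral of the Jacobian determinant of
  \<open>x + h G x\<close>, and the vanishing trace removes its linear term in \<open>h\<close>. As
  \<open>C\<close> depends on \<open>B\<close> and the dimension alone, one constant serves every
  set and every step of an Euler iteration.\<close>

lemma measure_image_near_identity_vec:
  fixes B :: real
  assumes "0 \<le> B"
  obtains C where "0 \<le> C"
    and "\<And>(G :: real^'k::{finite,wellorder} \<Rightarrow> real^'k::_) G' S h.
      \<lbrakk>compact S; \<And>x. x \<in> S \<Longrightarrow> (G has_derivative G' x) (at x);
       \<And>x j. x \<in> S \<Longrightarrow> norm (G' x (axis j 1)) \<le> B; \<And>x. x \<in> S \<Longrightarrow> trace (matrix (G' x)) = 0;
       inj_on (\<lambda>x. x + h *\<^sub>R G x) S; \<bar>h\<bar> \<le> 1\<rbrakk> \<Longrightarrow>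
      (1 - C * h\<^sup>2) * measure lebesgue S \<le> measure lebesgue ((\<lambda>x. x + h *\<^sub>R G x) ` S)"
proof -
  obtain C where C: "C \<ge> 0" "\<And>(A::real^'k::_^'k::_) h. (\<And>i j. \<bar>A$i$j\<bar> \<le> B) \<Longrightarrow> \<bar>h\<bar> \<le> 1 \<Longrightarrow>
           \<bar>det (mat 1 + h *\<^sub>R A) - 1 - h * trace A\<bar> \<le> C * h\<^sup>2"
    by (fact det_one_plus_small[OF assms])
  have "(1 - C * h\<^sup>2) * measure lebesgue S \<le> measure lebesgue ((\<lambda>x. x + h *\<^sub>R G x) ` S)"
    if S: "compact S" and der: "\<And>x. x \<in> S \<Longrightarrow> (G has_derivative G' x) (at x)"
      and B: "\<And>x j. x \<in> S \<Longrightarrow> norm (G' x (axis j 1)) \<le> B"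
      and tr: "\<And>x. x \<in> S \<Longrightarrow> trace (matrix (G' x)) = 0"
      and inj: "inj_on (\<lambda>x. x + h *\<^sub>R G x) S" and h: "\<bar>h\<bar> \<le> 1"
    for G :: "real^'k::_ \<Rightarrow> real^'k::_" and G' S h
  proof -
    let ?E = "\<lambda>x. x + h *\<^sub>R G x"
    let ?E' = "\<lambda>x v. v + h *\<^sub>R G' x v"
    have derE: "(?E has_derivative ?E' x) (at x within S)" if "x \<in> S" for x
      by (rule has_derivative_add[OF has_derivative_ident has_derivative_scaleR_right
            [OF has_derivative_at_withinI[OF der[OF that]]]])
    have "continuous_on S ?E"
      using derE has_derivative_continuous continuous_on_eq_continuous_within by blast
    then have "compact (?E ` S)" using S by (rule compact_continuous_image)
    then have "?E ` S \<in> lmeasurable" by (rule lmeasurable_compact)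
    then have int: "((\<lambda>x. \<bar>det (matrix (?E' x))\<bar>) has_integral measure lebesgue (?E ` S)) S"
      using has_measure_differentiable_image[OF _ derE inj] S
      by (auto simp: fmeasurableD lmeasurable_compact)
    have "((\<lambda>x. 1) has_integral measure lebesgue S) S"
      by (metis S lmeasurable_compact lmeasure_integral lmeasurable_iff_integrable_on integrable_integral)
    then have int1: "((\<lambda>x. (1 - C * h\<^sup>2) * 1) has_integral (1 - C * h\<^sup>2) * measure lebesgue S) S"
      by (rule has_integral_mult_right)
    show ?thesis
    proof (rule has_integral_le[OF int1 int])
      fix x assume x: "x \<in> S"
      have "matrix (?E' x) = mat 1 + h *\<^sub>R matrix (G' x)"
        by (simp add: matrix_def mat_def vec_eq_iff axis_def)
      moreover have "\<bar>matrix (G' x)$i$j\<bar> \<le> B" for i j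
        using B[OF x, of j] component_le_norm_cart[of "G' x (axis j 1)" i] by (simp add: matrix_def)
      ultimately show "(1 - C * h\<^sup>2) * 1 \<le> \<bar>det (matrix (?E' x))\<bar>"
        using C(2)[of "matrix (G' x)" h] h tr[OF x] by (auto simp: abs_le_iff)
    qed
  qed
  then show thesis by (rule that[OF C(1)])
qed

section \<open>Transport between a Euclidean space and its coordinate space\<close>

text \<open>\<open>L\<close> lists the coordinates in the standard basis and \<open>M\<close> is its
  inverse. Measure is preserved because \<open>L\<close> pulls boxes back to boxes with the same
  side lengths.\<close>

lemma isometry_to_vec:
  assumes "CARD('k::finite) = DIM('a::euclidean_space)"
  obtains L :: "'a::euclidean_space \<Rightarrow> real^'k" and M :: "real^'k \<Rightarrow> 'a" and \<sigma> :: "'k \<Rightarrow> 'a" where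
    "linear L" "linear M" "\<And>x. M (L x) = x" "\<And>y. L (M y) = y"
    "\<And>x. norm (L x) = norm x" "bij_betw \<sigma> UNIV Basis" "\<And>x i. L x $ i = x \<bullet> \<sigma> i"
    "\<And>i. M (axis i 1) = \<sigma> i"
    "\<And>K. compact K \<Longrightarrow> measure lebesgue (L ` K) = measure lebesgue K"
proof -
  obtain \<sigma> :: "'k \<Rightarrow> 'a" where s: "bij_betw \<sigma> UNIV Basis"
    using assms finite_same_card_bij[of "UNIV::'k set" "Basis::'a set"] by auto
  have sB: "\<sigma> i \<in> Basis" for i using s by (auto simp: bij_betw_def)
  have ss: "\<sigma> i \<bullet> \<sigma> j = (if i = j then 1 else 0)" for i j
    using s sB[of i] sB[of j] by (auto simp: inner_Basis bij_betw_def inj_on_def)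
  define L :: "'a \<Rightarrow> real^'k" where "L x = (\<chi> i. x \<bullet> \<sigma> i)" for x
  define M :: "real^'k \<Rightarrow> 'a" where "M y = (\<Sum>i\<in>UNIV. y$i *\<^sub>R \<sigma> i)" for y
  have linL: "linear L" by (auto intro!: linearI simp: L_def vec_eq_iff inner_add_left)
  have linM: "linear M" by (auto intro!: linearI simp: M_def scaleR_add_left sum.distrib scaleR_sum_right)
  have Ms: "M y \<bullet> \<sigma> j = y$j" for y j
    by (simp add: M_def inner_sum_left ss if_distrib cong: if_cong)
  have MoL: "M (L x) = x" for x
    unfolding M_def L_def using sum.reindex_bij_betw[OF s, of "\<lambda>b. (x \<bullet> b) *\<^sub>R b"]
    by (simp add: euclidean_representation)
  have LM: "L (M y) = y" for y by (simp add: L_def Ms vec_eq_iff)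
  have norm: "norm (L x) = norm x" for x
  proof -
    have "norm (L x)^2 = (\<Sum>i\<in>UNIV. (x \<bullet> \<sigma> i)^2)"
      unfolding power2_norm_eq_inner by (simp add: inner_vec_def L_def power2_eq_square)
    also have "\<dots> = (\<Sum>b\<in>Basis. (x \<bullet> b)^2)"
      using sum.reindex_bij_betw[OF s, of "\<lambda>b. (x \<bullet> b)^2"] .
    also have "\<dots> = norm x ^2"
      unfolding power2_norm_eq_inner euclidean_inner[of x x] by (simp add: power2_eq_square)
    finally show ?thesis by simp
  qed
  have axisM: "M (axis i 1) = \<sigma> i" for i
    by (simp add: M_def axis_def if_distrib if_distribR cong: if_cong)
  have Lb: "L \<in> borel_measurable borel"
    using linL by (intro borel_measurable_continuous_onI linear_continuous_on) (simp add: linear_conv_bounded_linear)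
  have prodB: "(\<Prod>b\<in>Basis. (M u - M l) \<bullet> b) = (\<Prod>b\<in>Basis. (u - l) \<bullet> b)" for l u
  proof -
    have "(\<Prod>b\<in>Basis. (M u - M l) \<bullet> b) = (\<Prod>i\<in>UNIV. (M u - M l) \<bullet> \<sigma> i)"
      using prod.reindex_bij_betw[OF s, of "\<lambda>b. (M u - M l) \<bullet> b"] by simp
    also have "\<dots> = (\<Prod>i\<in>UNIV. (u - l) $ i)" by (simp add: inner_diff_left Ms)
    also have "\<dots> = (\<Prod>b\<in>Basis. (u - l) \<bullet> b)"
    proof -
      have "bij_betw (\<lambda>i::'k. axis i (1::real)) UNIV Basis"
        by (auto simp: bij_betw_def inj_on_def axis_eq_axis Basis_vec_def)
      from prod.reindex_bij_betw[OF this, of "\<lambda>b. (u - l) \<bullet> b"] show ?thesis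
        by (simp add: inner_axis)
    qed
    finally show ?thesis .
  qed
  have range_s: "Basis = range \<sigma>" using s by (simp add: bij_betw_def)
  have all_s: "(\<forall>b\<in>Basis. P b) \<longleftrightarrow> (\<forall>i. P (\<sigma> i))" for P :: "'a \<Rightarrow> bool"
    unfolding range_s by blast
  \<comment> \<open>Lebesgue measure is determined by its values on boxes, so it suffices to compare
    those.\<close>
  have distr: "lborel = distr lborel borel L"
  proof (rule lborel_eqI)
    fix l u :: "real^'k" assume le: "\<And>b. b \<in> Basis \<Longrightarrow> l \<bullet> b \<le> u \<bullet> b"
    have "l $ i \<le> u $ i" for i
      using le[of "axis i 1"] by (simp add: inner_axis axis_in_Basis_iff)
    then have Mle: "\<And>b. b \<in> Basis \<Longrightarrow> M l \<bullet> b \<le> M u \<bullet> b"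
      using all_s[of "\<lambda>b. M l \<bullet> b \<le> M u \<bullet> b"] by (simp add: Ms)
    have "L -` box l u = box (M l) (M u)"
    proof (rule set_eqI)
      fix x
      have "x \<in> L -` box l u \<longleftrightarrow> (\<forall>i. l $ i < x \<bullet> \<sigma> i \<and> x \<bullet> \<sigma> i < u $ i)"
        by (simp add: mem_box_cart L_def)
      also have "\<dots> \<longleftrightarrow> x \<in> box (M l) (M u)" by (simp add: mem_box all_s Ms)
      finally show "x \<in> L -` box l u \<longleftrightarrow> x \<in> box (M l) (M u)" .
    qed
    then show "emeasure (distr lborel borel L) (box l u) = ennreal (\<Prod>b\<in>Basis. (u - l) \<bullet> b)"
      using Mle Lb by (simp add: emeasure_distr prodB[symmetric])
  qed simp
  have meas: "measure lebesgue (L ` K) = measure lebesgue K" if K: "compact K" for K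
  proof -
    have "compact (L ` K)"
      using K linL by (intro compact_continuous_image linear_continuous_on) (simp_all add: linear_conv_bounded_linear)
    moreover have "L -` L ` K = K" by (rule inj_vimage_image_eq) (metis MoL injI)
    ultimately have "emeasure lborel (L ` K) = emeasure lborel K"
      by (subst distr) (simp add: emeasure_distr Lb borel_compact)
    then show ?thesis
      using K \<open>compact (L ` K)\<close> by (simp add: measure_def borel_compact)
  qed
  show ?thesis
    by (rule that[of L M \<sigma>]) (use linL linM MoL LM norm s axisM meas in \<open>auto simp: L_def\<close>)
qed

text \<open>The library's change of variables formula needs a well-ordered index type, whence \<open>'k\<close>.\<close>

lemma measure_image_near_identity:
  fixes B :: real
  assumes card: "CARD('k::{finite,wellorder}) = DIM('a::euclidean_space)" and "0 \<le> B"
  obtains C where "0 \<le> C"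
    and "\<And>(G :: 'a::euclidean_space \<Rightarrow> 'a) G' S h.
      \<lbrakk>compact S; \<And>x. x \<in> S \<Longrightarrow> (G has_derivative G' x) (at x);
       \<And>x b. x \<in> S \<Longrightarrow> b \<in> Basis \<Longrightarrow> norm (G' x b) \<le> B;
       \<And>x. x \<in> S \<Longrightarrow> (\<Sum>b\<in>Basis. G' x b \<bullet> b) = 0;
       inj_on (\<lambda>x. x + h *\<^sub>R G x) S; \<bar>h\<bar> \<le> 1\<rbrakk> \<Longrightarrow>
      (1 - C * h\<^sup>2) * measure lebesgue S \<le> measure lebesgue ((\<lambda>x. x + h *\<^sub>R G x) ` S)"
proof -
  obtain L :: "'a \<Rightarrow> real^'k::_" and M :: "real^'k::_ \<Rightarrow> 'a" and \<sigma> :: "'k \<Rightarrow> 'a" where LM: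
    "linear L" "linear M" "\<And>x. M (L x) = x" "\<And>y. L (M y) = y"
    "\<And>x. norm (L x) = norm x" "bij_betw \<sigma> UNIV Basis" "\<And>x i. L x $ i = x \<bullet> \<sigma> i"
    "\<And>i. M (axis i 1) = \<sigma> i"
    "\<And>K. compact K \<Longrightarrow> measure lebesgue (L ` K) = measure lebesgue K"
    by (fact isometry_to_vec[OF card])
  note bl = LM(1,2)[unfolded linear_conv_bounded_linear]
  have sB: "\<sigma> i \<in> Basis" for i using LM(6) by (auto simp: bij_betw_def)
  obtain C where C: "C \<ge> 0" "\<And>(G :: real^'k::_ \<Rightarrow> real^'k::_) G' S h.
      \<lbrakk>compact S; \<And>x. x \<in> S \<Longrightarrow> (G has_derivative G' x) (at x);
       \<And>x j. x \<in> S \<Longrightarrow> norm (G' x (axis j 1)) \<le> B; \<And>x. x \<in> S \<Longrightarrow> trace (matrix (G' x)) = 0;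
       inj_on (\<lambda>x. x + h *\<^sub>R G x) S; \<bar>h\<bar> \<le> 1\<rbrakk> \<Longrightarrow>
      (1 - C * h\<^sup>2) * measure lebesgue S \<le> measure lebesgue ((\<lambda>x. x + h *\<^sub>R G x) ` S)"
    by (fact measure_image_near_identity_vec[OF assms(2)])
  have "(1 - C * h\<^sup>2) * measure lebesgue S \<le> measure lebesgue ((\<lambda>x. x + h *\<^sub>R G x) ` S)"
    if S: "compact S" and der: "\<And>x. x \<in> S \<Longrightarrow> (G has_derivative G' x) (at x)"
      and B: "\<And>x b. x \<in> S \<Longrightarrow> b \<in> Basis \<Longrightarrow> norm (G' x b) \<le> B"
      and tr: "\<And>x. x \<in> S \<Longrightarrow> (\<Sum>b\<in>Basis. G' x b \<bullet> b) = 0"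
      and inj: "inj_on (\<lambda>x. x + h *\<^sub>R G x) S" and h: "\<bar>h\<bar> \<le> 1"
    for G :: "'a \<Rightarrow> 'a" and G' S h
  proof -
    let ?E = "\<lambda>x. x + h *\<^sub>R G x"
    \<comment> \<open>Conjugating the Euler map of \<open>G\<close> by \<open>L\<close> gives the
      Euler map of \<open>L o G o M\<close>, so the coordinate version applies to the transported
      field.\<close>
    have LE: "(\<lambda>y. y + h *\<^sub>R L (G (M y))) ` L ` S = L ` ?E ` S"
      by (auto simp: image_iff LM linear_add[OF LM(1)] linear_scale[OF LM(1)])
    have cE: "continuous_on S ?E"
      by (intro continuous_intros continuous_at_imp_continuous_on)
        (blast intro: der has_derivative_continuous)
    have "(1 - C * h\<^sup>2) * measure lebesgue (L ` S)
        \<le> measure lebesgue ((\<lambda>y. y + h *\<^sub>R L (G (M y))) ` L ` S)"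
    proof (rule C(2)[where G' = "\<lambda>y v. L (G' (M y) (M v))"])
      show "compact (L ` S)"
        using S bl by (intro compact_continuous_image linear_continuous_on) auto
      show "((\<lambda>y. L (G (M y))) has_derivative (\<lambda>v. L (G' (M y) (M v)))) (at y)" if yS: "y \<in> L ` S" for y
      proof -
        obtain x where x: "x \<in> S" and y: "y = L x" using yS by blast
        have "(M has_derivative M) (at (L x))" using bl by (simp add: bounded_linear_imp_has_derivative)
        then have "((\<lambda>y. G (M y)) has_derivative (\<lambda>v. G' x (M v))) (at (L x))"
          using der[OF x] has_derivative_compose[of M M "L x" UNIV G "G' x"] by (simp add: LM)
        from bounded_linear.has_derivative[OF bl(1) this]
        show ?thesis by (simp add: LM y)
      qed
      show "norm (L (G' (M y) (M (axis j 1)))) \<le> B" if "y \<in> L ` S" for y j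
        using that B sB by (auto simp: LM)
      show "trace (matrix (\<lambda>v. L (G' (M y) (M v)))) = 0" if yS: "y \<in> L ` S" for y
      proof -
        obtain x where x: "x \<in> S" and y: "y = L x" using yS by blast
        have "trace (matrix (\<lambda>v. L (G' (M (L x)) (M v)))) = (\<Sum>i\<in>UNIV. G' x (\<sigma> i) \<bullet> \<sigma> i)"
          by (simp add: trace_def matrix_def LM)
        also have "\<dots> = (\<Sum>b\<in>Basis. G' x b \<bullet> b)"
          using sum.reindex_bij_betw[OF LM(6), of "\<lambda>b. G' x b \<bullet> b"] .
        finally show ?thesis using tr[OF x] y by simp
      qed
      show "inj_on (\<lambda>y. y + h *\<^sub>R L (G (M y))) (L ` S)"
      proof (rule inj_onI, safe)
        fix x y assume "x \<in> S" "y \<in> S" "L x + h *\<^sub>R L (G (M (L x))) = L y + h *\<^sub>R L (G (M (L y)))"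
        then have "L (?E x) = L (?E y)" by (simp add: LM linear_add[OF LM(1)] linear_scale[OF LM(1)])
        then have "?E x = ?E y" by (metis LM(3))
        then show "L x = L y" using inj \<open>x \<in> S\<close> \<open>y \<in> S\<close> by (auto dest: inj_onD)
      qed
    qed (use h in auto)
    then show ?thesis
      unfolding LE using S compact_continuous_image[OF cE S] by (simp add: LM(9))
  qed
  then show thesis by (rule that[OF C(1)])
qed

section \<open>Liouville's theorem\<close>

text \<open>The norms of the partial derivatives plus the norm of \<open>G\<close> form a continuous
  function, bounded by some \<open>B\<close> on the compact ball. The sum of the partials dominates
  the operator norm, and the ball is convex, so the mean value inequality makes the same
  \<open>B\<close> a Lipschitz constant.\<close>

lemma C1_bounds_on_cball:
  fixes G :: "'a::euclidean_space \<Rightarrow> 'a"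
  assumes der: "\<And>x. (G has_derivative G' x) (at x)"
    and cont: "\<And>b. continuous_on UNIV (\<lambda>x. G' x b)"
  obtains B where "0 \<le> B"
    and "\<And>x b. x \<in> cball 0 R \<Longrightarrow> b \<in> Basis \<Longrightarrow> norm (G' x b) \<le> B"
    and "\<And>x. x \<in> cball 0 R \<Longrightarrow> norm (G x) \<le> B"
    and "\<And>x y. x \<in> cball 0 R \<Longrightarrow> y \<in> cball 0 R \<Longrightarrow> norm (G x - G y) \<le> B * norm (x - y)"
proof -
  let ?f = "\<lambda>x. (\<Sum>b\<in>Basis. norm (G' x b)) + norm (G x)"
  have cG: "continuous_on (cball 0 R) G"
    by (rule continuous_at_imp_continuous_on) (blast intro: der has_derivative_continuous)
  have "continuous_on (cball 0 R) ?f"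
    by (intro continuous_on_add continuous_on_sum continuous_on_norm cG
          continuous_on_subset[OF cont subset_UNIV])
  then have "bounded (?f ` cball 0 R)"
    by (intro compact_imp_bounded compact_continuous_image) auto
  then obtain B where B: "B > 0" "\<And>x. x \<in> cball 0 R \<Longrightarrow> norm (?f x) \<le> B"
    unfolding bounded_pos by blast
  have nonneg: "0 \<le> (\<Sum>b\<in>Basis. norm (G' x b))" for x by (rule sum_nonneg) simp
  have le: "(\<Sum>b\<in>Basis. norm (G' x b)) \<le> B" "norm (G x) \<le> B" if "x \<in> cball 0 R" for x
    using B(2)[OF that] nonneg[of x] norm_ge_zero[of "G x"] unfolding real_norm_def by linarith+
  have 1: "norm (G' x b) \<le> B" if "x \<in> cball 0 R" "b \<in> Basis" for x b
    using le(1)[OF that(1)] member_le_sum[of b Basis "\<lambda>b. norm (G' x b)"] that(2) by simp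
  have 2: "norm (G x - G y) \<le> B * norm (x - y)" if "x \<in> cball 0 R" "y \<in> cball 0 R" for x y
  proof (rule differentiable_bound[OF convex_cball _ _ that])
    fix x :: 'a assume x: "x \<in> cball 0 R"
    show "(G has_derivative G' x) (at x within cball 0 R)"
      by (rule has_derivative_at_withinI[OF der])
    show "onorm (G' x) \<le> B"
      using onorm_componentwise[OF has_derivative_bounded_linear[OF der]] le(1)[OF x]
      by (rule order_trans)
  qed
  show thesis by (rule that[of B]) (use B(1) 1 2 le(2) in auto)
qed

section \<open>Stability of trajectories and the error of Euler's method\<close>

text \<open>Gronwall's argument: the squared distance of two trajectories, damped by
  \<open>exp (- 2 * L * u)\<close>, has nonpositive derivative by the Cauchy--Schwarz inequality and
  the Lipschitz bound.\<close>

lemma solutions_diverge_at_most_exponentially: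
  fixes G :: "'a::euclidean_space \<Rightarrow> 'a"
  assumes y: "\<And>s. s \<in> {0..1} \<Longrightarrow> (y has_vector_derivative G (y s)) (at s within {0..1})"
    and z: "\<And>s. s \<in> {0..1} \<Longrightarrow> (z has_vector_derivative G (z s)) (at s within {0..1})"
    and X: "\<And>s. s \<in> {0..1} \<Longrightarrow> y s \<in> X" "\<And>s. s \<in> {0..1} \<Longrightarrow> z s \<in> X"
    and Lip: "\<And>x x'. x \<in> X \<Longrightarrow> x' \<in> X \<Longrightarrow> norm (G x - G x') \<le> L * norm (x - x')"
    and s: "s \<in> {0..1}"
  shows "norm (y s - z s) \<le> exp (L * s) * norm (y 0 - z 0)"
proof -
  define D where "D u = (y u - z u) \<bullet> (y u - z u)" for u
  let ?W = "\<lambda>u. exp (- 2 * L * u) * D u"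
  have cont: "continuous_on {0..1} y" "continuous_on {0..1} z"
    using y z has_vector_derivative_continuous continuous_on_eq_continuous_within by blast+
  have "?W s \<le> ?W 0"
  proof (rule DERIV_nonpos_imp_decreasing_open[where f = ?W and a = 0 and b = s])
    show "0 \<le> s" using s by simp
    show "continuous_on {0..s} ?W"
      unfolding D_def using s
      by (intro continuous_intros continuous_on_subset[OF cont(1)] continuous_on_subset[OF cont(2)]) auto
    fix u assume u: "0 < u" "u < s"
    \<comment> \<open>Only interior times matter for monotonicity; there the derivative within the
      interval is the ordinary two-sided one.\<close>
    then have u01: "0 < u" "u < 1" "u \<in> {0..1}" using s by auto
    let ?d = "y u - z u" and ?g = "G (y u) - G (z u)"
    have "((\<lambda>u. y u - z u) has_vector_derivative ?g) (at u)"
      using has_vector_derivative_diff[OF y[OF u01(3)] z[OF u01(3)]] u01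
      by (simp add: at_within_Icc_at)
    from bounded_bilinear.has_vector_derivative[OF bounded_bilinear_inner this this]
    have dD: "(D has_real_derivative 2 * (?d \<bullet> ?g)) (at u)"
      unfolding D_def has_real_derivative_iff_has_vector_derivative by (simp add: inner_commute)
    have "(?W has_real_derivative exp (- 2 * L * u) * (2 * (?d \<bullet> ?g) - 2 * L * D u)) (at u)"
      by (rule derivative_eq_intros dD refl)+ (simp add: algebra_simps)
    moreover have "?d \<bullet> ?g \<le> L * D u"
    proof -
      have "?d \<bullet> ?g \<le> norm ?d * norm ?g" by (rule norm_cauchy_schwarz)
      also have "\<dots> \<le> norm ?d * (L * norm ?d)"
        using Lip X u01 by (intro mult_left_mono) auto
      finally show ?thesis
        by (simp add: D_def power2_norm_eq_inner[symmetric] power2_eq_square algebra_simps)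
    qed
    ultimately show "\<exists>w. (?W has_real_derivative w) (at u) \<and> w \<le> 0"
      by (intro exI conjI) (auto simp: mult_le_0_iff)
  qed
  then have "exp (2 * L * s) * ?W s \<le> exp (2 * L * s) * D 0" by simp
  then have "D s \<le> exp (2 * L * s) * D 0"
    by (simp add: mult.assoc[symmetric] exp_add[symmetric])
  then have "(norm (y s - z s))\<^sup>2 \<le> (exp (L * s) * norm (y 0 - z 0))\<^sup>2"
    by (simp add: D_def power2_norm_eq_inner power_mult_distrib exp_double[symmetric] mult.assoc)
  then show ?thesis by (rule power2_le_imp_le) simp
qed

text \<open>\<open>B\<close> bounds both the speed and the Lipschitz constant of \<open>G\<close>.
  During one step \<open>y\<close> moves by at most \<open>B * h\<close>, so \<open>G\<close> along
  \<open>y\<close> varies by at most \<open>B * B * h\<close>, and integrating over time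
  \<open>h\<close> gives the quadratic error.\<close>

lemma euler_local_error:
  fixes G :: "'a::euclidean_space \<Rightarrow> 'a"
  assumes y: "\<And>s. s \<in> {0..1} \<Longrightarrow> (y has_vector_derivative G (y s)) (at s within {0..1})"
    and X: "\<And>s. s \<in> {0..1} \<Longrightarrow> y s \<in> X"
    and Lip: "\<And>x x'. x \<in> X \<Longrightarrow> x' \<in> X \<Longrightarrow> norm (G x - G x') \<le> B * norm (x - x')"
    and bd: "\<And>x. x \<in> X \<Longrightarrow> norm (G x) \<le> B"
    and s: "0 \<le> s" "0 \<le> h" "s + h \<le> 1" and "0 \<le> B"
  shows "norm (y (s + h) - (y s + h *\<^sub>R G (y s))) \<le> B * B * h\<^sup>2"
proof -
  let ?S = "{s..s+h}"
  have S: "?S \<subseteq> {0..1}" using s by auto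
  have y': "(y has_vector_derivative G (y u)) (at u within ?S)" if "u \<in> ?S" for u
    using that S y has_vector_derivative_within_subset by blast
  have 1: "norm (y u - y s) \<le> B * h" if u: "u \<in> ?S" for u
  proof -
    have "norm (y u - y s) \<le> B * norm (u - s)"
    proof (rule differentiable_bound[of ?S y "\<lambda>u r. r *\<^sub>R G (y u)"])
      fix v assume v: "v \<in> ?S"
      show "(y has_derivative (\<lambda>r. r *\<^sub>R G (y v))) (at v within ?S)"
        using y'[OF v] by (simp add: has_vector_derivative_def)
      show "onorm (\<lambda>r. r *\<^sub>R G (y v)) \<le> B"
        using bd X v S by (intro onorm_le) (auto intro!: mult_left_mono simp: mult.commute[of B])
    qed (use u s in auto)
    also have "\<dots> \<le> B * h" using u \<open>0 \<le> B\<close> by (intro mult_left_mono) auto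
    finally show ?thesis .
  qed
  have "norm (y (s + h) - y s - ((s + h) - s) *\<^sub>R G (y s)) \<le> norm ((s + h) - s) * (B * (B * h))"
  proof (rule vector_differentiable_bound_linearization[OF y'])
    show "closed_segment s (s + h) \<subseteq> ?S" using s by (simp add: closed_segment_eq_real_ivl)
    fix u assume u: "u \<in> ?S"
    have "norm (G (y u) - G (y s)) \<le> B * norm (y u - y s)" using u s S by (intro Lip X) auto
    also have "\<dots> \<le> B * (B * h)" using 1[OF u] \<open>0 \<le> B\<close> by (rule mult_left_mono)
    finally show "norm (G (y u) - G (y s)) \<le> B * (B * h)" .
  qed (use s in auto)
  then show ?thesis using s by (simp add: power2_eq_square algebra_simps)
qed

text \<open>Each step multiplies the error by at most \<open>1 + B * h \<le> exp (B * h)\<close> and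
  adds one local error. The bounds on \<open>G\<close> are assumed on a ball of radius
  \<open>R + 1\<close>: trajectories stay within \<open>R\<close>, and \<open>small\<close> keeps
  the error at most one, so the Euler points remain where the bounds hold.\<close>

lemma euler_global_error:
  fixes G :: "'a::euclidean_space \<Rightarrow> 'a"
  defines "E \<equiv> \<lambda>h x. x + h *\<^sub>R G x"
  assumes y: "\<And>s. s \<in> {0..1} \<Longrightarrow> (y has_vector_derivative G (y s)) (at s within {0..1})"
    and yR: "\<And>s. s \<in> {0..1} \<Longrightarrow> y s \<in> cball 0 R"
    and Lip: "\<And>x x'. x \<in> cball 0 (R + 1) \<Longrightarrow> x' \<in> cball 0 (R + 1) \<Longrightarrow> norm (G x - G x') \<le> B * norm (x - x')"
    and bd: "\<And>x. x \<in> cball 0 (R + 1) \<Longrightarrow> norm (G x) \<le> B"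
    and "0 \<le> B" and n: "0 < n" and small: "B * B * exp B / real n \<le> 1" and k: "k \<le> n"
  shows "norm (y (k / n) - (E (1 / n) ^^ k) (y 0)) \<le> B * B * exp B / n"
    and "(E (1 / n) ^^ k) (y 0) \<in> cball 0 (R + 1)"
proof -
  let ?h = "1 / real n" and ?x = "\<lambda>k. (E (1 / n) ^^ k) (y 0)"
  \<comment> \<open>\<open>?e k\<close> adds up \<open>k\<close> local errors, each amplified by at
    most the growth over the whole elapsed time \<open>k / n\<close>.\<close>
  let ?e = "\<lambda>k. real k * (B * B * ?h\<^sup>2) * exp (B * (k / n))"
  have e: "?e k \<le> B * B * exp B / n" if "k \<le> n" for k
  proof -
    have "?e k \<le> real n * (B * B * ?h\<^sup>2) * exp (B * 1)"
      using that n \<open>0 \<le> B\<close> mult_left_mono[of "real k / n" 1 B] by (intro mult_mono) auto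
    also have "\<dots> = B * B * exp B / n" using n by (simp add: power2_eq_square)
    finally show ?thesis .
  qed
  have near: "x \<in> cball 0 (R + 1)" if "norm (y (k / n) - x) \<le> ?e k" "k \<le> n" for x k
  proof -
    have "norm (y (k / n)) \<le> R" using yR[of "k / n"] that n by simp
    moreover have "norm (y (k / n) - x) \<le> 1" using that e[of k] small by linarith
    moreover have "norm x \<le> norm (y (k / n)) + norm (y (k / n) - x)"
      using norm_triangle_ineq4[of "y (k / n)" "y (k / n) - x"] by simp
    ultimately show ?thesis by simp
  qed
  have err: "k \<le> n \<Longrightarrow> norm (y (k / n) - ?x k) \<le> ?e k" for k
  proof (induction k)
    case 0
    then show ?case by simp
  next
    case (Suc k)
    let ?s = "real k / n"
    have IH: "norm (y ?s - ?x k) \<le> ?e k" using Suc by simp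
    have sh: "real (Suc k) / n = ?s + ?h" by (simp add: add_divide_distrib)
    have s1: "0 \<le> ?s" "?s + ?h \<le> 1" "?s \<le> 1" using Suc.prems n by (auto simp: field_simps)
    have loc: "norm (y (?s + ?h) - (y ?s + ?h *\<^sub>R G (y ?s))) \<le> B * B * ?h\<^sup>2"
      using yR s1 \<open>0 \<le> B\<close>
      by (intro euler_local_error[of y G "cball 0 (R + 1)"] y Lip bd) force+
    have "norm (G (y ?s) - G (?x k)) \<le> B * norm (y ?s - ?x k)"
      using near[OF IH] Suc.prems yR[of ?s] s1 by (intro Lip) auto
    then have G: "norm (?h *\<^sub>R (G (y ?s) - G (?x k))) \<le> ?h * (B * norm (y ?s - ?x k))"
      by (simp add: divide_right_mono)
    have split: "y (?s + ?h) - ?x (Suc k) = (y (?s + ?h) - (y ?s + ?h *\<^sub>R G (y ?s)))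
        + (y ?s - ?x k) + ?h *\<^sub>R (G (y ?s) - G (?x k))"
      by (simp add: E_def algebra_simps)
    have "norm (y (?s + ?h) - ?x (Suc k)) \<le> B * B * ?h\<^sup>2 + norm (y ?s - ?x k)
        + ?h * (B * norm (y ?s - ?x k))"
      unfolding split
      by (intro order_trans[OF norm_triangle_ineq] add_mono loc G order_refl)
    also have "\<dots> = B * B * ?h\<^sup>2 + (1 + B * ?h) * norm (y ?s - ?x k)" by (simp add: algebra_simps)
    \<comment> \<open>The new local error is enlarged by an exponential factor at least one, so that
      it becomes the missing summand of \<open>?e (Suc k)\<close>.\<close>
    also have "\<dots> \<le> B * B * ?h\<^sup>2 * exp (B * (?s + ?h)) + exp (B * ?h) * ?e k"
    proof (rule add_mono)
      have "B * B * ?h\<^sup>2 * 1 \<le> B * B * ?h\<^sup>2 * exp (B * (?s + ?h))"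
        using \<open>0 \<le> B\<close> s1 by (intro mult_left_mono) auto
      then show "B * B * ?h\<^sup>2 \<le> B * B * ?h\<^sup>2 * exp (B * (?s + ?h))" by simp
      show "(1 + B * ?h) * norm (y ?s - ?x k) \<le> exp (B * ?h) * ?e k"
        using \<open>0 \<le> B\<close> by (intro mult_mono[OF exp_ge_add_one_self IH]) simp_all
    qed
    also have "\<dots> = ?e (Suc k)"
      unfolding sh distrib_left[of B] exp_add by (simp add: algebra_simps)
    finally show ?case unfolding sh .
  qed
  show "norm (y (k / n) - ?x k) \<le> B * B * exp B / n" using err[OF k] e[OF k] by linarith
  show "?x k \<in> cball 0 (R + 1)" using near[OF err[OF k] k] .
qed

section \<open>The time-one map on compact sets\<close>

text \<open>The family \<open>Y\<close> supplies a trajectory for every starting point in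
  \<open>K\<close>. The common radius \<open>R\<close> yields one bound \<open>B\<close> for all
  Euler iterates, and with it one distortion constant \<open>C\<close>.\<close>

lemma measure_time_one_map_ge:
  fixes G :: "'a::euclidean_space \<Rightarrow> 'a" and Y :: "'a \<Rightarrow> real \<Rightarrow> 'a"
  assumes card: "CARD('k::{finite,wellorder}) = DIM('a)"
    and der: "\<And>x. (G has_derivative G' x) (at x)"
    and cont: "\<And>b. continuous_on UNIV (\<lambda>x. G' x b)"
    and div0: "\<And>x. (\<Sum>b\<in>Basis. G' x b \<bullet> b) = 0"
    and K: "compact K"
    and Y0: "\<And>a. a \<in> K \<Longrightarrow> Y a 0 = a"
    and Y: "\<And>a s. a \<in> K \<Longrightarrow> s \<in> {0..1} \<Longrightarrow>
              (Y a has_vector_derivative G (Y a s)) (at s within {0..1})"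
    and R: "\<And>a s. a \<in> K \<Longrightarrow> s \<in> {0..1} \<Longrightarrow> Y a s \<in> cball 0 R"
  shows "compact ((\<lambda>a. Y a 1) ` K)"
    and "measure lebesgue K \<le> measure lebesgue ((\<lambda>a. Y a 1) ` K)"
proof -
  define P where "P a = Y a 1" for a
  define E where "E h x = x + h *\<^sub>R G x" for h x
  let ?X = "cball (0::'a) (R + 1)"
  obtain B where B: "0 \<le> B"
    "\<And>x b. x \<in> ?X \<Longrightarrow> b \<in> Basis \<Longrightarrow> norm (G' x b) \<le> B"
    "\<And>x. x \<in> ?X \<Longrightarrow> norm (G x) \<le> B"
    "\<And>x y. x \<in> ?X \<Longrightarrow> y \<in> ?X \<Longrightarrow> norm (G x - G y) \<le> B * norm (x - y)"
    using C1_bounds_on_cball[OF der cont, of "R + 1"] by blast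
  have RX: "Y a s \<in> ?X" if "a \<in> K" "s \<in> {0..1}" for a s
    using R[OF that] by simp
  obtain C where C: "0 \<le> C"
    "\<And>(G :: 'a \<Rightarrow> 'a) G' S h.
      \<lbrakk>compact S; \<And>x. x \<in> S \<Longrightarrow> (G has_derivative G' x) (at x);
       \<And>x b. x \<in> S \<Longrightarrow> b \<in> Basis \<Longrightarrow> norm (G' x b) \<le> B;
       \<And>x. x \<in> S \<Longrightarrow> (\<Sum>b\<in>Basis. G' x b \<bullet> b) = 0;
       inj_on (\<lambda>x. x + h *\<^sub>R G x) S; \<bar>h\<bar> \<le> 1\<rbrakk> \<Longrightarrow>
      (1 - C * h\<^sup>2) * measure lebesgue S \<le> measure lebesgue ((\<lambda>x. x + h *\<^sub>R G x) ` S)"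
    by (fact measure_image_near_identity[OF card B(1)])
  have "norm (P a - P b) \<le> exp B * norm (a - b)" if "a \<in> K" "b \<in> K" for a b
    using solutions_diverge_at_most_exponentially[of "Y a" G "Y b" ?X B 1] that Y Y0 RX B(4)
    by (simp add: P_def)
  then have "continuous_on K P"
    by (intro lipschitz_on_continuous_on[of "exp B"] lipschitz_onI) (auto simp: dist_norm)
  with K have PK: "compact (P ` K)" by (intro compact_continuous_image)
  then show "compact ((\<lambda>a. Y a 1) ` K)" by (simp add: P_def[abs_def])
  have contE: "continuous_on S (E h)" for S h
    unfolding E_def
    by (intro continuous_intros continuous_at_imp_continuous_on)
      (blast intro: der has_derivative_continuous)
  have "measure lebesgue K \<le> measure lebesgue (P ` K) + 2 * \<epsilon>" if "\<epsilon> > 0" for \<epsilon>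
  proof -
    obtain U where U: "open U" "P ` K \<subseteq> U" "U - P ` K \<in> lmeasurable"
      "emeasure lebesgue (U - P ` K) < ennreal \<epsilon>"
      using sets_lebesgue_outer_open[of "P ` K" \<epsilon>] PK \<open>\<epsilon> > 0\<close>
      by (metis fmeasurableD lmeasurable_compact)
    have "measure lebesgue (U - P ` K) < \<epsilon>"
      using U(3,4) by (simp add: emeasure_eq_measure2 ennreal_less_iff)
    moreover have Um: "U \<in> lmeasurable"
      using fmeasurable.Un[OF lmeasurable_compact[OF PK] U(3)] U(2) by (simp add: Un_absorb1)
    moreover have "measure lebesgue U \<le> measure lebesgue (P ` K) + measure lebesgue (U - P ` K)"
      using measure_Un_le[of "P ` K" lebesgue "U - P ` K"] U(2,3) PK
      by (simp add: Un_absorb1 fmeasurableD lmeasurable_compact)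
    ultimately have mU: "measure lebesgue U \<le> measure lebesgue (P ` K) + \<epsilon>" by linarith
    obtain \<delta> where \<delta>: "\<delta> > 0" "(\<Union>x\<in>P ` K. ball x \<delta>) \<subseteq> U"
      using compact_subset_open_imp_ball_epsilon_subset[OF PK U(1,2)] by blast
    have "eventually (\<lambda>n. c / real n < d) sequentially" if "0 < d" for c d :: real
      using order_tendstoD(2)[OF lim_const_over_n that] .
    \<comment> \<open>In order: the Euler error stays below one (iterates remain in
      \<open>?X\<close>) and below \<open>\<delta>\<close> (endpoints lie in \<open>U\<close>), one
      step is injective, the distortion factor is nonnegative, and the total loss is below
      \<open>\<epsilon>\<close>.\<close>
    then have "eventually (\<lambda>n. 0 < n \<and> B * B * exp B / real n < min 1 \<delta> \<and> B / real n < 1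
        \<and> C / real n < 1 \<and> C * measure lebesgue K / real n < \<epsilon>) sequentially"
      using \<delta>(1) \<open>\<epsilon> > 0\<close> by (intro eventually_conj eventually_gt_at_top) (simp_all add: eventually_conj)
    then obtain n :: nat where n: "0 < n" "B * B * exp B / n < min 1 \<delta>" "B / n < 1" "C / n < 1"
      "C * measure lebesgue K / n < \<epsilon>"
      using eventually_sequentially by auto
    let ?h = "1 / real n"
    let ?S = "\<lambda>k. (E ?h ^^ k) ` K"
    have h: "0 \<le> ?h" "?h \<le> 1" using n(1) by auto
    have SX: "?S k \<subseteq> ?X" if "k \<le> n" for k
    proof safe
      fix a assume a: "a \<in> K"
      show "(E ?h ^^ k) a \<in> ?X"
        using euler_global_error(2)[where y = "Y a" and R = R and B = B and n = n, OF Y[OF a] R[OF a] B(4,3,1) n(1) _ that]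
          n(2) Y0[OF a] by (simp add: E_def[abs_def])
    qed
    have cS: "compact (?S k)" for k
    proof (induction k)
      case (Suc k)
      have "?S (Suc k) = E ?h ` ?S k" by (simp add: image_comp)
      then show ?case using Suc contE compact_continuous_image by metis
    qed (use K in simp)
    \<comment> \<open>The displacement \<open>?h * G\<close> has Lipschitz constant
      \<open>B / n < 1\<close> on the ball, so it cannot cancel the difference of two distinct
      points.\<close>
    have inj: "inj_on (E ?h) ?X"
    proof (rule inj_onI, rule ccontr)
      fix x y assume xy: "x \<in> ?X" "y \<in> ?X" "E ?h x = E ?h y" "x \<noteq> y"
      then have "x - y = ?h *\<^sub>R (G y - G x)" by (simp add: E_def algebra_simps)
      then have "norm (x - y) = ?h * norm (G y - G x)" using h(1) by simp
      also have "\<dots> \<le> ?h * (B * norm (y - x))" using B(4) xy h(1) by (intro mult_left_mono) auto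
      also have "\<dots> = B / n * norm (x - y)" by (simp add: norm_minus_commute)
      also have "\<dots> < 1 * norm (x - y)" using n(3) xy by (intro mult_strict_right_mono) auto
      finally show False by simp
    qed
    have q: "0 \<le> 1 - C * ?h\<^sup>2"
    proof -
      have "C * ?h\<^sup>2 = C / n * ?h" by (simp add: power2_eq_square)
      also have "\<dots> \<le> 1 * 1" using n(4) h C(1) by (intro mult_mono) auto
      finally show ?thesis by simp
    qed
    have step: "(1 - C * ?h\<^sup>2) * measure lebesgue (?S k) \<le> measure lebesgue (?S (Suc k))"
      if k: "k < n" for k
    proof -
      have X: "x \<in> ?X" if "x \<in> ?S k" for x using SX[of k] k that by auto
      have "(1 - C * ?h\<^sup>2) * measure lebesgue (?S k)
          \<le> measure lebesgue ((\<lambda>x. x + ?h *\<^sub>R G x) ` ?S k)"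
      proof (rule C(2)[OF cS der B(2)[OF X] div0])
        have "?S k \<subseteq> ?X" using SX[of k] k by simp
        from inj_on_subset[OF inj this]
        show "inj_on (\<lambda>x. x + ?h *\<^sub>R G x) (?S k)" by (simp add: E_def[abs_def])
      qed (use h in auto)
      also have "(\<lambda>x. x + ?h *\<^sub>R G x) ` ?S k = ?S (Suc k)"
        by (simp add: image_comp E_def[abs_def] comp_def)
      finally show ?thesis .
    qed
    have "k \<le> n \<Longrightarrow> (1 - C * ?h\<^sup>2) ^ k * measure lebesgue K \<le> measure lebesgue (?S k)" for k
    proof (induction k)
      case (Suc k)
      have "(1 - C * ?h\<^sup>2) ^ Suc k * measure lebesgue K
          \<le> (1 - C * ?h\<^sup>2) * measure lebesgue (?S k)"
        using Suc q mult_left_mono[of "(1 - C * ?h\<^sup>2) ^ k * measure lebesgue K" "measure lebesgue (?S k)" "1 - C * ?h\<^sup>2"]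
        by (simp add: mult.assoc)
      also have "\<dots> \<le> measure lebesgue (?S (Suc k))" using Suc.prems by (intro step) auto
      finally show ?case .
    qed simp
    then have Sn: "(1 - C * ?h\<^sup>2) ^ n * measure lebesgue K \<le> measure lebesgue (?S n)" by simp
    \<comment> \<open>Bernoulli's inequality: \<open>n\<close> steps that each lose
      \<open>C / n^2\<close> lose at most \<open>C / n\<close> together.\<close>
    have "1 - C / n = 1 + real n * - (C * ?h\<^sup>2)" using n(1) by (simp add: power2_eq_square)
    also have "\<dots> \<le> (1 + - (C * ?h\<^sup>2)) ^ n" using q by (intro Bernoulli_inequality) auto
    finally have "(1 - C / n) * measure lebesgue K \<le> (1 - C * ?h\<^sup>2) ^ n * measure lebesgue K"
      by (intro mult_right_mono) auto
    moreover have "?S n \<subseteq> U"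
    proof safe
      fix a assume a: "a \<in> K"
      have "norm (Y a (real n / n) - (E ?h ^^ n) (Y a 0)) \<le> B * B * exp B / n"
        using euler_global_error(1)[where y = "Y a" and R = R and B = B and n = n and k = n, OF Y[OF a] R[OF a] B(4,3,1) n(1)]
          n(2) by (simp add: E_def[abs_def])
      then have "(E ?h ^^ n) a \<in> ball (P a) \<delta>"
        using n(1,2) Y0[OF a] by (simp add: P_def dist_norm)
      then show "(E ?h ^^ n) a \<in> U" using \<delta>(2) a by blast
    qed
    then have "measure lebesgue (?S n) \<le> measure lebesgue U"
      using Um cS by (intro measure_mono_fmeasurable) (auto simp: fmeasurableD lmeasurable_compact)
    ultimately have "(1 - C / n) * measure lebesgue K \<le> measure lebesgue (P ` K) + \<epsilon>"
      using Sn mU by linarith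
    then show ?thesis using n(5) by (simp add: algebra_simps)
  qed
  note le = this
  have "measure lebesgue K \<le> measure lebesgue (P ` K)"
  proof (rule field_le_epsilon)
    fix e :: real assume "e > 0"
    then show "measure lebesgue K \<le> measure lebesgue (P ` K) + e" using le[of "e / 2"] by simp
  qed
  then show "measure lebesgue K \<le> measure lebesgue ((\<lambda>a. Y a 1) ` K)" by (simp add: P_def[abs_def])
qed

text \<open>Running the trajectories backwards gives trajectories of \<open>- G\<close>, which is
  again divergence free and confined to the same ball. The lower bound for them, starting from the
  image of \<open>K\<close>, is the missing upper bound.\<close>

lemma measure_time_one_map:
  fixes G :: "'a::euclidean_space \<Rightarrow> 'a" and Y :: "'a \<Rightarrow> real \<Rightarrow> 'a"
  assumes card: "CARD('k::{finite,wellorder}) = DIM('a)"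
    and der: "\<And>x. (G has_derivative G' x) (at x)"
    and cont: "\<And>b. continuous_on UNIV (\<lambda>x. G' x b)"
    and div0: "\<And>x. (\<Sum>b\<in>Basis. G' x b \<bullet> b) = 0"
    and K: "compact K"
    and Y0: "\<And>a. a \<in> K \<Longrightarrow> Y a 0 = a"
    and Y: "\<And>a s. a \<in> K \<Longrightarrow> s \<in> {0..1} \<Longrightarrow>
              (Y a has_vector_derivative G (Y a s)) (at s within {0..1})"
    and R: "\<And>a s. a \<in> K \<Longrightarrow> s \<in> {0..1} \<Longrightarrow> Y a s \<in> cball 0 R"
  shows "measure lebesgue ((\<lambda>a. Y a 1) ` K) = measure lebesgue K"
proof (rule antisym)
  let ?P = "\<lambda>a. Y a 1"
  \<comment> \<open>\<open>?Q b\<close> selects a starting point in \<open>K\<close> whose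
    trajectory ends at \<open>b\<close>; reversing that trajectory leads from \<open>b\<close> back
    into \<open>K\<close>.\<close>
  let ?Q = "inv_into K ?P"
  let ?Z = "\<lambda>b s. Y (?Q b) (1 - s)"
  have PK: "compact (?P ` K)"
    by (rule measure_time_one_map_ge(1)[OF card der cont div0 K Y0 Y R])
  have Q: "?Q b \<in> K" "?P (?Q b) = b" if "b \<in> ?P ` K" for b
    using inv_into_into[OF that] f_inv_into_f[OF that] by simp_all
  have Z: "(?Z b has_vector_derivative - G (?Z b s)) (at s within {0..1})"
    if b: "b \<in> ?P ` K" and s: "s \<in> {0..1}" for b s
  proof -
    have "((\<lambda>s. 1 - s) has_vector_derivative - 1) (at s within {0..1})"
      by (auto intro!: derivative_eq_intros)
    moreover have "(\<lambda>s::real. 1 - s) ` {0..1} = {0..1}"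
      by (auto simp: image_iff intro!: bexI[of _ "1 - x" for x])
    ultimately show ?thesis
      using vector_diff_chain_within[of "\<lambda>s. 1 - s" "- 1" s "{0..1}" "Y (?Q b)" "G (?Z b s)"]
        Y[OF Q(1)[OF b], of "1 - s"] s by (simp add: comp_def)
  qed
  have der': "((\<lambda>x. - G x) has_derivative (\<lambda>v. - G' x v)) (at x)" for x
    by (rule has_derivative_minus[OF der])
  have cont': "continuous_on UNIV (\<lambda>x. - G' x b)" for b by (rule continuous_on_minus[OF cont])
  have div0': "(\<Sum>b\<in>Basis. - G' x b \<bullet> b) = 0" for x using div0[of x] by (simp add: sum_negf)
  have Z0: "?Z b 0 = b" if "b \<in> ?P ` K" for b using Q(2)[OF that] by simp
  have ZR: "?Z b s \<in> cball 0 R" if "b \<in> ?P ` K" "s \<in> {0..1}" for b s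
    using that by (intro R Q) auto
  note rev = measure_time_one_map_ge[OF card der' cont' div0' PK Z0 Z ZR]
  have "measure lebesgue (?P ` K) \<le> measure lebesgue ((\<lambda>b. ?Z b 1) ` ?P ` K)" by (rule rev(2))
  also have "\<dots> \<le> measure lebesgue K"
  proof (rule measure_mono_fmeasurable)
    show "(\<lambda>b. ?Z b 1) ` ?P ` K \<subseteq> K" using Q(1) Y0 by auto
    show "(\<lambda>b. ?Z b 1) ` ?P ` K \<in> sets lebesgue"
      by (rule fmeasurableD[OF lmeasurable_compact[OF rev(1)]])
    show "K \<in> lmeasurable" by (rule lmeasurable_compact[OF K])
  qed
  finally show "measure lebesgue (?P ` K) \<le> measure lebesgue K" .
  show "measure lebesgue K \<le> measure lebesgue (?P ` K)"
    by (rule measure_time_one_map_ge(2)[OF card der cont div0 K Y0 Y R])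
qed


text \<open>Rescaling time by \<open>t\<close> reduces the flow up to time \<open>t\<close>, of either sign, to time one.\<close>

lemma solution_rescaled:
  assumes z: "solution F (closed_segment 0 t) z" and s: "s \<in> {0..1}"
  shows "((\<lambda>s. z (t * s)) has_vector_derivative t *\<^sub>R F (z (t * s))) (at s within {0..1})"
proof -
  have seg: "(\<lambda>s. t * s) ` {0..1} = closed_segment 0 t"
    by (force simp: in_segment image_iff mult.commute)
  have "t * s \<in> closed_segment 0 t" unfolding seg[symmetric] using s by (rule imageI)
  then have "(z has_vector_derivative F (z (t * s))) (at (t * s) within (\<lambda>s. t * s) ` {0..1})"
    using z unfolding solution_def seg by blast
  moreover have "((\<lambda>s. t * s) has_vector_derivative t) (at s within {0..1})"
    by (auto intro!: derivative_eq_intros)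
  ultimately show ?thesis
    using vector_diff_chain_within[of "\<lambda>s. t * s" t s "{0..1}" z] by (simp add: comp_def)
qed

section \<open>From compact sets to all Lebesgue measurable sets\<close>

text \<open>The hypothesis \<open>bounded\<close> confines, up to time \<open>t\<close>, all
  trajectories that start in a given ball. This provides a radius for the compact case and a
  Lipschitz constant of the flow on every bounded set of initial values.\<close>

theorem divergence_free_imp_flow_preserves_lebesgue:
  fixes F :: "'a::euclidean_space \<Rightarrow> 'a"
  assumes card: "CARD('k::{finite,wellorder}) = DIM('a)"
    and der: "\<And>x. (F has_derivative F' x) (at x)"
    and cont: "\<And>b. continuous_on UNIV (\<lambda>x. F' x b)"
    and div0: "\<And>x. (\<Sum>b\<in>Basis. F' x b \<bullet> b) = 0"
    and bounded: "\<And>t R. \<exists>R'. \<forall>z. solution F (closed_segment 0 t) z \<and> norm (z 0) \<le> R \<longrightarrow>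
                    (\<forall>s\<in>closed_segment 0 t. norm (z s) \<le> R')"
  shows "flow_preserves_lebesgue F"
  unfolding flow_preserves_lebesgue_def
proof (intro allI impI)
  fix t and A :: "'a set" assume A: "A \<in> sets lebesgue \<and> A \<subseteq> flow_domain F t"
  let ?I = "closed_segment 0 t" and ?P = "flow F t" and ?G = "\<lambda>x. t *\<^sub>R F x"
  have derG: "(?G has_derivative (\<lambda>v. t *\<^sub>R F' x v)) (at x)" for x
    by (rule has_derivative_scaleR_right[OF der])
  have contG: "continuous_on UNIV (\<lambda>x. t *\<^sub>R F' x b)" for b
    by (intro continuous_intros cont)
  have div0G: "(\<Sum>b\<in>Basis. t *\<^sub>R F' x b \<bullet> b) = 0" for x
    using div0[of x] by (simp add: sum_distrib_left[symmetric])
  have ts: "t * s \<in> ?I" if "s \<in> {0..1}" for s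
    using that by (auto simp: in_segment intro!: exI[of _ s])
  \<comment> \<open>This estimate serves twice: with equal initial values it gives uniqueness, so
    that the definite description in \<open>flow\<close> denotes; with different ones it makes the
    flow locally Lipschitz.\<close>
  have lip: "\<exists>L. \<forall>y z. solution F ?I y \<and> solution F ?I z \<and> norm (y 0) \<le> R \<and> norm (z 0) \<le> R \<longrightarrow>
      norm (y t - z t) \<le> L * norm (y 0 - z 0)" for R
  proof -
    obtain R' where R': "\<And>z s. solution F ?I z \<Longrightarrow> norm (z 0) \<le> R \<Longrightarrow> s \<in> ?I \<Longrightarrow> norm (z s) \<le> R'"
      using bounded[of t R] by blast
    obtain B where "0 \<le> B"
      and "\<And>x b. x \<in> cball 0 R' \<Longrightarrow> b \<in> Basis \<Longrightarrow> norm (t *\<^sub>R F' x b) \<le> B"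
      and "\<And>x. x \<in> cball 0 R' \<Longrightarrow> norm (?G x) \<le> B"
      and B: "\<And>x y. x \<in> cball 0 R' \<Longrightarrow> y \<in> cball 0 R' \<Longrightarrow> norm (?G x - ?G y) \<le> B * norm (x - y)"
      by (fact C1_bounds_on_cball[OF derG contG, of R'])
    have "norm (y t - z t) \<le> exp B * norm (y 0 - z 0)"
      if yz: "solution F ?I y" "solution F ?I z" "norm (y 0) \<le> R" "norm (z 0) \<le> R" for y z
    proof -
      have "norm (y (t * 1) - z (t * 1)) \<le> exp (B * 1) * norm (y (t * 0) - z (t * 0))"
        by (rule solutions_diverge_at_most_exponentially[where X = "cball 0 R'",
              OF solution_rescaled[OF yz(1)] solution_rescaled[OF yz(2)] _ _ B])
          (use R'[OF yz(1,3) ts] R'[OF yz(2,4) ts] in auto)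
      then show ?thesis by simp
    qed
    then show ?thesis by blast
  qed
  have flow_eq: "?P a = z t" if z: "solution F ?I z" "z 0 = a" for a z
    unfolding flow_def
  proof (rule the_equality)
    fix b assume "\<exists>z. solution F ?I z \<and> z 0 = a \<and> z t = b"
    then obtain y where y: "solution F ?I y" "y 0 = a" "y t = b" by blast
    then show "b = z t" using lip[of "norm a"] z by fastforce
  qed (use z in blast)
  define Z where "Z a = (SOME z. solution F ?I z \<and> z 0 = a)" for a
  have Z: "solution F ?I (Z a)" "Z a 0 = a" if "a \<in> flow_domain F t" for a
    using someI_ex[of "\<lambda>z. solution F ?I z \<and> z 0 = a"] that by (auto simp: flow_domain_def Z_def)
  have PZ: "?P a = Z a t" if "a \<in> flow_domain F t" for a
    using flow_eq Z[OF that] by blast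
  have compact_case: "?P ` K \<in> sets lebesgue \<and> emeasure lebesgue (?P ` K) = emeasure lebesgue K"
    if K: "compact K" "K \<subseteq> flow_domain F t" for K
  proof -
    obtain R where R: "\<And>a. a \<in> K \<Longrightarrow> norm a \<le> R"
      using compact_imp_bounded[OF K(1)] unfolding bounded_iff by blast
    obtain R' where R': "\<And>z s. solution F ?I z \<Longrightarrow> norm (z 0) \<le> R \<Longrightarrow> s \<in> ?I \<Longrightarrow> norm (z s) \<le> R'"
      using bounded[of t R] by blast
    let ?Y = "\<lambda>a s. Z a (t * s)"
    have Y0: "?Y a 0 = a" if "a \<in> K" for a using Z(2) K(2) that by auto
    have Y: "(?Y a has_vector_derivative ?G (?Y a s)) (at s within {0..1})"
      if "a \<in> K" "s \<in> {0..1}" for a s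
      using solution_rescaled[OF Z(1)] K(2) that by blast
    have YR: "?Y a s \<in> cball 0 R'" if "a \<in> K" "s \<in> {0..1}" for a s
    proof -
      have a: "a \<in> flow_domain F t" using K(2) that(1) by blast
      show ?thesis using R'[OF Z(1)[OF a] _ ts[OF that(2)]] R[OF that(1)] Z(2)[OF a] by simp
    qed
    have PY: "?P ` K = (\<lambda>a. ?Y a 1) ` K"
      using PZ K(2) by (intro image_cong) auto
    have "compact (?P ` K)" "measure lebesgue (?P ` K) = measure lebesgue K"
      unfolding PY
      by (rule measure_time_one_map_ge(1)[OF card derG contG div0G K(1) Y0 Y YR]
          measure_time_one_map[OF card derG contG div0G K(1) Y0 Y YR]; assumption)+
    then show ?thesis
      using K(1) by (simp add: emeasure_eq_measure2 lmeasurable_compact fmeasurableD)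
  qed
  \<comment> \<open>A Lebesgue set is a countable union of closed sets up to a null set, and the
    closed sets may be taken compact.\<close>
  obtain C T where CT: "fsigma C" "T \<in> null_sets lebesgue" "C \<union> T = A"
    using lebesgue_set_almost_fsigma A by metis
  obtain D :: "nat \<Rightarrow> 'a set" where D: "\<And>i. compact (D i)" "C = \<Union>(range D)"
    using CT(1) unfolding fsigma_Union_compact by (metis image_subset_iff mem_Collect_eq UNIV_I)
  \<comment> \<open>Finite unions make the compact sets increasing, and so are their images; both
    measures then pass to the supremum.\<close>
  let ?E = "\<lambda>n. \<Union>i\<le>n. D i"
  have E: "compact (?E n)" "?E n \<subseteq> flow_domain F t" for n
    using D A CT(3) by (auto intro!: compact_UN)
  have UE: "(\<Union>n. ?E n) = C" unfolding D(2) by blast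
  have UPE: "(\<Union>n. ?P ` ?E n) = ?P ` C" unfolding D(2) by blast
  have incE: "incseq ?E" "incseq (\<lambda>n. ?P ` ?E n)"
    by (auto simp: incseq_def intro: order_trans)
  have ranE: "range ?E \<subseteq> sets lebesgue" "range (\<lambda>n. ?P ` ?E n) \<subseteq> sets lebesgue"
    using compact_case[OF E] E(1) by (auto simp: fmeasurableD lmeasurable_compact)
  have PC: "?P ` C \<in> sets lebesgue" using ranE(2) UPE by (metis sets.countable_UN)
  have Cl: "C \<in> sets lebesgue" using ranE(1) UE by (metis sets.countable_UN)
  have "emeasure lebesgue (?P ` C) = (SUP n. emeasure lebesgue (?P ` ?E n))"
    using SUP_emeasure_incseq[OF ranE(2) incE(2)] UPE by simp
  also have "\<dots> = (SUP n. emeasure lebesgue (?E n))" using compact_case[OF E] by simp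
  also have "\<dots> = emeasure lebesgue C"
    using SUP_emeasure_incseq[OF ranE(1) incE(1)] UE by simp
  finally have eC: "emeasure lebesgue (?P ` C) = emeasure lebesgue C" .
  \<comment> \<open>Locally Lipschitz maps between spaces of equal dimension send null sets to null
    sets; the unit ball around \<open>a\<close> serves as neighbourhood.\<close>
  have "negligible (?P ` T)"
  proof (rule negligible_locally_Lipschitz_image)
    show "negligible T" using CT(2) by (simp add: negligible_iff_null_sets)
    fix a assume a: "a \<in> T"
    obtain L where L: "\<And>y z. solution F ?I y \<Longrightarrow> solution F ?I z \<Longrightarrow> norm (y 0) \<le> norm a + 1 \<Longrightarrow>
        norm (z 0) \<le> norm a + 1 \<Longrightarrow> norm (y t - z t) \<le> L * norm (y 0 - z 0)"
      using lip[of "norm a + 1"] by blast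
    have dom: "T \<subseteq> flow_domain F t" using A CT(3) by blast
    have "norm (?P b - ?P a) \<le> L * norm (b - a)" if b: "b \<in> T \<inter> ball a 1" for b
    proof -
      have "norm b \<le> norm a + 1"
        using b norm_triangle_ineq2[of b a] by (simp add: dist_norm norm_minus_commute)
      then show ?thesis
        using L[OF Z(1) Z(1), of b a] Z(2) PZ a b dom by (simp add: subset_iff)
    qed
    then show "\<exists>U B. open U \<and> a \<in> U \<and> (\<forall>b\<in>T \<inter> U. norm (?P b - ?P a) \<le> B * norm (b - a))"
      by (intro exI[of _ "ball a 1"] exI[of _ L]) auto
  qed simp
  then have PT: "?P ` T \<in> null_sets lebesgue" by (simp add: negligible_iff_null_sets)
  have PA: "?P ` A = ?P ` C \<union> ?P ` T" using CT(3) by blast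
  have "emeasure lebesgue (?P ` A) = emeasure lebesgue A"
    unfolding PA CT(3)[symmetric]
    using eC emeasure_Un_null_set[OF PC PT] emeasure_Un_null_set[OF Cl CT(2)] by (simp add: image_Un)
  then show "?P ` A \<in> sets lebesgue \<and> emeasure lebesgue (?P ` A) = emeasure lebesgue A"
    unfolding PA using PC PT by auto
qed

section \<open>Continuously differentiable maps\<close>

text \<open>The regularity that the volume argument asks of the field. The closure rules below carry
  it from the derivatives of \<open>f\<close> to \<open>ode_field f\<close>.\<close>

definition C1 :: "('a::euclidean_space \<Rightarrow> 'b::real_normed_vector) \<Rightarrow> bool" where
  "C1 g \<longleftrightarrow> C_k (Suc 0) g"

lemma C1_I:
  assumes "\<And>x. (g has_derivative g' x) (at x)" and "\<And>u. continuous_on UNIV (\<lambda>x. g' x u)"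
  shows "C1 g"
proof -
  have "frechet_derivative g (at x) = g' x" for x
    using frechet_derivative_at[OF assms(1)] by simp
  then show ?thesis
    using assms by (auto simp: C1_def differentiable_on_def differentiable_def intro: has_derivative_at_withinI)
qed

lemma C1_D:
  assumes "C1 g"
  shows "(g has_derivative frechet_derivative g (at x)) (at x)"
    and "continuous_on UNIV (\<lambda>x. frechet_derivative g (at x) u)"
    and "continuous_on UNIV g"
  using assms
  by (auto simp: C1_def differentiable_on_def frechet_derivative_works[symmetric] intro: differentiable_imp_continuous_on)

lemma C1_const: "C1 (\<lambda>x. c)"
  by (rule C1_I[where g' = "\<lambda>x u. 0"]) auto

lemma C1_linear: "linear h \<Longrightarrow> C1 h" for h :: "'a::euclidean_space \<Rightarrow> 'b::euclidean_space"
  by (rule C1_I[where g' = "\<lambda>x. h"]) (auto simp: linear_conv_bounded_linear intro: bounded_linear_imp_has_derivative)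

lemma C1_linear_compose:
  fixes h :: "'b::euclidean_space \<Rightarrow> 'c::euclidean_space"
  assumes "linear h" and "C1 g"
  shows "C1 (\<lambda>x. h (g x))"
proof (rule C1_I)
  have bl: "bounded_linear h" using assms(1) by (simp add: linear_conv_bounded_linear)
  show "((\<lambda>x. h (g x)) has_derivative (\<lambda>u. h (frechet_derivative g (at x) u))) (at x)" for x
    by (rule bounded_linear.has_derivative[OF bl C1_D(1)[OF assms(2)]])
  show "continuous_on UNIV (\<lambda>x. h (frechet_derivative g (at x) u))" for u
    by (rule bounded_linear.continuous_on[OF bl C1_D(2)[OF assms(2)]])
qed

lemma C1_compose_linear:
  fixes p :: "'a::euclidean_space \<Rightarrow> 'b::euclidean_space"
  assumes "linear p" and "C1 g"
  shows "C1 (\<lambda>x. g (p x))"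
proof (rule C1_I)
  have bl: "bounded_linear p" using assms(1) by (simp add: linear_conv_bounded_linear)
  have "(p has_derivative p) (at x)" for x by (rule bounded_linear_imp_has_derivative[OF bl])
  then show "((\<lambda>x. g (p x)) has_derivative (\<lambda>u. frechet_derivative g (at (p x)) (p u))) (at x)" for x
    using C1_D(1)[OF assms(2)] by (rule has_derivative_compose)
  show "continuous_on UNIV (\<lambda>x. frechet_derivative g (at (p x)) (p u))" for u
    using continuous_on_compose[OF linear_continuous_on[OF bl], of UNIV "\<lambda>x. frechet_derivative g (at x) (p u)"]
      continuous_on_subset[OF C1_D(2)[OF assms(2)] subset_UNIV] by (simp add: comp_def)
qed

lemma C1_bilinear:
  assumes "bounded_bilinear p" and "C1 f" and "C1 g"
  shows "C1 (\<lambda>x. p (f x) (g x))"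
proof (rule C1_I)
  show "((\<lambda>x. p (f x) (g x)) has_derivative
      (\<lambda>u. p (f x) (frechet_derivative g (at x) u) + p (frechet_derivative f (at x) u) (g x))) (at x)" for x
    by (rule bounded_bilinear.FDERIV[OF assms(1) C1_D(1)[OF assms(2)] C1_D(1)[OF assms(3)]])
  show "continuous_on UNIV (\<lambda>x. p (f x) (frechet_derivative g (at x) u) + p (frechet_derivative f (at x) u) (g x))" for u
    by (intro continuous_on_add bounded_bilinear.continuous_on[OF assms(1)] C1_D(2,3) assms)
qed

lemma C1_add: "C1 f \<Longrightarrow> C1 g \<Longrightarrow> C1 (\<lambda>x. f x + g x)"
  by (rule C1_I[where g' = "\<lambda>x u. frechet_derivative f (at x) u + frechet_derivative g (at x) u"])
    (intro has_derivative_add continuous_on_add C1_D; assumption)+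

lemma C1_diff: "C1 f \<Longrightarrow> C1 g \<Longrightarrow> C1 (\<lambda>x. f x - g x)"
  by (rule C1_I[where g' = "\<lambda>x u. frechet_derivative f (at x) u - frechet_derivative g (at x) u"])
    (intro has_derivative_diff continuous_on_diff C1_D; assumption)+

lemma C1_sum: "(\<And>i. i \<in> I \<Longrightarrow> C1 (f i)) \<Longrightarrow> C1 (\<lambda>x. \<Sum>i\<in>I. f i x)"
  by (induction I rule: infinite_finite_induct) (auto intro: C1_const C1_add)

lemma C1_prod: "(\<And>i. i \<in> I \<Longrightarrow> C1 (f i)) \<Longrightarrow> C1 (\<lambda>x. \<Prod>i\<in>I. f i x :: real)"
  by (induction I rule: infinite_finite_induct)
    (auto intro: C1_const C1_bilinear[OF bounded_bilinear_mult])

lemma C1_inverse: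
  fixes g :: "'a::euclidean_space \<Rightarrow> real"
  assumes "C1 g" and "\<And>x. g x \<noteq> 0"
  shows "C1 (\<lambda>x. inverse (g x))"
proof (rule C1_I)
  show "((\<lambda>x. inverse (g x)) has_derivative
      (\<lambda>u. - (inverse (g x) * frechet_derivative g (at x) u * inverse (g x)))) (at x)" for x
    by (rule Deriv.has_derivative_inverse[OF assms(2) C1_D(1)[OF assms(1)]])
  show "continuous_on UNIV (\<lambda>x. - (inverse (g x) * frechet_derivative g (at x) u * inverse (g x)))" for u
    using assms(2) by (intro continuous_intros C1_D(2,3)[OF assms(1)]) auto
qed

section \<open>Vector- and matrix-valued maps\<close>

lemma linear_axis: "linear (axis i :: 'b::real_vector \<Rightarrow> 'b^'n)"
  by (rule linearI) (auto simp: vec_eq_iff axis_def)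

lemma linear_vec_nth: "linear (\<lambda>x. x $ i :: 'b::real_vector)"
  by (rule linearI) auto

lemma C1_vec:
  fixes g :: "'n::finite \<Rightarrow> 'a::euclidean_space \<Rightarrow> 'b::euclidean_space"
  assumes "\<And>i. C1 (g i)"
  shows "C1 (\<lambda>x. \<chi> i. g i x)"
proof -
  have "(\<lambda>x. \<chi> i. g i x) = (\<lambda>x. \<Sum>i\<in>UNIV. axis i (g i x))"
    by (simp add: fun_eq_iff vec_eq_iff axis_def)
  then show ?thesis
    by (simp only:) (intro C1_sum C1_linear_compose[OF linear_axis] assms)
qed

lemma C1_nth: "C1 g \<Longrightarrow> C1 (\<lambda>x. g x $ i)" for g :: "'a::euclidean_space \<Rightarrow> 'b::euclidean_space^'n"
  by (rule C1_linear_compose[OF linear_vec_nth])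

lemma C1_Pair:
  fixes f :: "'a::euclidean_space \<Rightarrow> 'b::euclidean_space" and g :: "'a \<Rightarrow> 'c::euclidean_space"
  assumes "C1 f" and "C1 g"
  shows "C1 (\<lambda>x. (f x, g x))"
proof -
  have "linear (\<lambda>b::'b. (b, 0::'c))" "linear (\<lambda>c::'c. (0::'b, c))" by (auto intro!: linearI)
  from C1_add[OF C1_linear_compose[OF this(1) assms(1)] C1_linear_compose[OF this(2) assms(2)]]
  show ?thesis by simp
qed

lemma bounded_bilinear_matrix_mult:
  "bounded_bilinear ((**) :: real^'n^'m \<Rightarrow> real^'p^'n \<Rightarrow> real^'p^'m)"
  unfolding bilinear_conv_bounded_bilinear[symmetric] bilinear_def
  by (auto intro!: linearI simp: matrix_matrix_mult_def vec_eq_iff sum.distrib algebra_simps sum_distrib_left)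

lemma bounded_bilinear_matrix_vector_mult:
  "bounded_bilinear ((*v) :: real^'n^'m \<Rightarrow> real^'n \<Rightarrow> real^'m)"
  unfolding bilinear_conv_bounded_bilinear[symmetric] bilinear_def
  by (auto intro!: linearI simp: matrix_vector_mult_def vec_eq_iff sum.distrib algebra_simps sum_distrib_left)

lemma linear_transpose: "linear (transpose :: real^'n^'m \<Rightarrow> real^'m^'n)"
  by (rule linearI) (auto simp: transpose_def vec_eq_iff)

lemmas C1_matrix_mult = C1_bilinear[OF bounded_bilinear_matrix_mult]
lemmas C1_matrix_vector_mult = C1_bilinear[OF bounded_bilinear_matrix_vector_mult]
lemmas C1_transpose = C1_linear_compose[OF linear_transpose]

lemma C1_det:
  fixes A :: "'a::euclidean_space \<Rightarrow> real^'n^'n"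
  assumes "C1 A"
  shows "C1 (\<lambda>x. det (A x))"
  unfolding det_def
  by (intro C1_sum C1_bilinear[OF bounded_bilinear_mult] C1_const C1_prod C1_nth assms)

lemma matrix_inv_props:
  fixes A :: "real^'n^'n"
  assumes "invertible A"
  shows "A ** matrix_inv A = mat 1" and "matrix_inv A ** A = mat 1"
  using someI_ex[OF assms[unfolded invertible_def]] unfolding matrix_inv_def by auto

lemma matrix_inv_unique:
  fixes A :: "real^'n^'n"
  assumes "A ** B = mat 1"
  shows "matrix_inv A = B"
proof -
  have "invertible A" using assms invertible_right_inverse by blast
  then show ?thesis
    by (metis assms matrix_inv_props(2) matrix_mul_assoc matrix_mul_lid matrix_mul_rid)
qed

text \<open>By Cramer's rule the entries of the inverse are quotients of determinants, and
  determinants are polynomials in the entries.\<close>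

lemma C1_matrix_inv:
  fixes A :: "'a::euclidean_space \<Rightarrow> real^'n^'n"
  assumes A: "C1 A" and inv: "\<And>x. invertible (A x)"
  shows "C1 (\<lambda>x. matrix_inv (A x))"
proof -
  have d: "det (A x) \<noteq> 0" for x using inv by (simp add: invertible_det_nz)
  \<comment> \<open>\<open>?M j k x\<close> is \<open>A x\<close> with column \<open>k\<close>
    replaced by the \<open>j\<close>-th unit vector, the numerator matrix for entry
    \<open>(k, j)\<close> of the inverse.\<close>
  let ?M = "\<lambda>j k x. \<chi> r c. if c = k then axis j 1 $ r else A x $ r $ c"
  have entry: "matrix_inv (A x) $ k $ j = det (?M j k x) * inverse (det (A x))" for x k j
  proof -
    have "A x *v (matrix_inv (A x) *v axis j 1) = axis j 1"
      using matrix_inv_props(1)[OF inv] by (simp add: matrix_vector_mul_assoc)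
    then have "matrix_inv (A x) *v axis j 1 = (\<chi> k. det (?M j k x) / det (A x))"
      using cramer[OF d] by blast
    then have "(matrix_inv (A x) *v axis j 1) $ k = det (?M j k x) / det (A x)" by simp
    then show ?thesis
      by (simp add: matrix_vector_mult_basis column_def divide_inverse)
  qed
  have "C1 (?M j k)" for j k
  proof (intro C1_vec)
    fix r c show "C1 (\<lambda>x. if c = k then axis j 1 $ r else A x $ r $ c)"
      by (cases "c = k") (simp_all add: C1_const C1_nth A)
  qed
  then have "C1 (\<lambda>x. det (?M j k x) * inverse (det (A x)))" for j k
    by (intro C1_bilinear[OF bounded_bilinear_mult] C1_det C1_inverse A d)
  then have "C1 (\<lambda>x. \<chi> k j. matrix_inv (A x) $ k $ j)"
    unfolding entry by (intro C1_vec)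
  then show ?thesis by simp
qed


lemma smooth_imp_C1: "smooth f \<Longrightarrow> C1 f"
  unfolding smooth_def C1_def by blast

lemma smooth_frechet_derivative: "smooth f \<Longrightarrow> smooth (\<lambda>x. frechet_derivative f (at x) u)"
  unfolding smooth_def by (metis C_k.simps(2))

text \<open>Expanding \<open>S b\<close> in the basis turns both sides into the same double sum of
  \<open>(S b \<bullet> c) *\<^sub>R \<phi> c b\<close>. It serves to move a symmetric matrix from
  one slot of a trace to the other.\<close>

lemma sum_Basis_selfadjoint:
  fixes \<phi> :: "'a::euclidean_space \<Rightarrow> 'a \<Rightarrow> 'b::real_vector"
  assumes l: "\<And>y. linear (\<lambda>x. \<phi> x y)" and r: "\<And>x. linear (\<phi> x)"
    and S: "\<And>x y. S x \<bullet> y = x \<bullet> S y"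
  shows "(\<Sum>b\<in>Basis. \<phi> (S b) b) = (\<Sum>b\<in>Basis. \<phi> b (S b))"
proof -
  have "\<phi> (S b) b = (\<Sum>c\<in>Basis. (S b \<bullet> c) *\<^sub>R \<phi> c b)" for b
    using linear_sum[OF l, of "\<lambda>c. (S b \<bullet> c) *\<^sub>R c" Basis b]
    by (simp add: euclidean_representation linear_scale[OF l])
  moreover have "\<phi> c (S c) = (\<Sum>b\<in>Basis. (S b \<bullet> c) *\<^sub>R \<phi> c b)" for c
  proof -
    have "S c = (\<Sum>b\<in>Basis. (S b \<bullet> c) *\<^sub>R b)"
      using euclidean_representation[of "S c"] S by (simp add: inner_commute)
    then have "\<phi> c (S c) = \<phi> c (\<Sum>b\<in>Basis. (S b \<bullet> c) *\<^sub>R b)" by simp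
    also have "\<dots> = (\<Sum>b\<in>Basis. (S b \<bullet> c) *\<^sub>R \<phi> c b)"
      by (simp add: linear_sum[OF r] linear_scale[OF r])
    finally show ?thesis .
  qed
  ultimately show ?thesis by (simp only:) (rule sum.swap)
qed

lemma inner_transpose_matrix_vector:
  fixes A :: "real^'n^'m"
  shows "x \<bullet> (transpose A *v y) = (A *v x) \<bullet> y"
  by (metis dot_lmul_matrix inner_commute transpose_matrix_vector)

lemma frechet_derivative_nth:
  fixes g :: "'a::euclidean_space \<Rightarrow> 'b::euclidean_space^'n"
  assumes "C1 g"
  shows "frechet_derivative (\<lambda>y. g y $ i) (at x) = (\<lambda>u. frechet_derivative g (at x) u $ i)"
  by (rule frechet_derivative_at[symmetric])
    (rule bounded_linear.has_derivative[OF bounded_linear_vec_nth C1_D(1)[OF assms]])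

section \<open>The constrained system\<close>

context
  fixes f :: "real^'n \<Rightarrow> real^'m"
  assumes rank: "\<And>x. rank (Jac f x) = CARD('m)"
begin

section \<open>Algebra of the two projections\<close>

text \<open>If \<open>J J^T y = 0\<close>, then \<open>J^T y\<close> has norm zero, and full row
  rank makes \<open>J^T\<close> injective. So \<open>matrix_inv\<close> in \<open>Jplus\<close> is a
  genuine inverse, and \<open>Jplus\<close> a right inverse of \<open>Jac\<close>.\<close>

lemma invertible_gram: "invertible (Jac f x ** transpose (Jac f x))"
proof -
  let ?J = "Jac f x"
  have inj: "inj ((*v) (transpose ?J))"
    by (metis rank full_rank_injective rank_transpose)
  have "y = 0" if "(?J ** transpose ?J) *v y = 0" for y
  proof -
    have "(transpose ?J *v y) \<bullet> (transpose ?J *v y) = (?J *v (transpose ?J *v y)) \<bullet> y"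
      by (rule inner_transpose_matrix_vector)
    also have "\<dots> = 0" using that by (simp only: matrix_vector_mul_assoc inner_zero_left)
    finally have "transpose ?J *v y = transpose ?J *v 0" by (simp del: transpose_matrix_vector)
    then show ?thesis using inj by (rule injD[rotated])
  qed
  then show ?thesis
    by (metis matrix_left_invertible_ker invertible_left_inverse)
qed

lemma Jac_Jplus: "Jac f x ** Jplus f x = mat 1"
  unfolding Jplus_def matrix_mul_assoc by (rule matrix_inv_props(1)[OF invertible_gram])

lemma Jac_Nproj: "Jac f x ** Nproj f x = Jac f x"
  unfolding Nproj_def by (simp add: matrix_mul_assoc Jac_Jplus)

lemma Nproj_Jplus: "Nproj f x ** Jplus f x = Jplus f x"
  unfolding Nproj_def by (simp add: matrix_mul_assoc[symmetric] Jac_Jplus)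

lemma Nproj_idem: "Nproj f x ** Nproj f x = Nproj f x"
  by (metis Nproj_Jplus Nproj_def matrix_mul_assoc)

text \<open>The Gram matrix is symmetric, hence so is its inverse, by uniqueness of
  inverses.\<close>

lemma transpose_Nproj: "transpose (Nproj f x) = Nproj f x"
proof -
  let ?A = "Jac f x ** transpose (Jac f x)"
  have "?A ** transpose (matrix_inv ?A) = transpose (matrix_inv ?A ** ?A)"
    by (simp add: matrix_transpose_mul)
  also have "\<dots> = mat 1" by (simp add: matrix_inv_props(2)[OF invertible_gram])
  finally have "transpose (matrix_inv ?A) = matrix_inv ?A" by (rule matrix_inv_unique[symmetric])
  then show ?thesis
    unfolding Nproj_def Jplus_def by (simp add: matrix_transpose_mul matrix_mul_assoc)
qed

lemma transpose_Tproj: "transpose (Tproj f x) = Tproj f x"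
  unfolding Tproj_def by (simp add: linear_diff[OF linear_transpose] transpose_Nproj)

lemma Jac_Tproj: "Jac f x ** Tproj f x = 0"
  unfolding Tproj_def by (simp add: bounded_bilinear.diff_right[OF bounded_bilinear_matrix_mult] Jac_Nproj)

lemma Tproj_idem: "Tproj f x ** Tproj f x = Tproj f x"
  and Tproj_Nproj: "Tproj f x ** Nproj f x = 0"
  and Tproj_Jplus: "Tproj f x ** Jplus f x = 0"
  unfolding Tproj_def
  by (simp_all add: bounded_bilinear.diff_right[OF bounded_bilinear_matrix_mult]
      bounded_bilinear.diff_left[OF bounded_bilinear_matrix_mult] Nproj_idem Nproj_Jplus)

text \<open>For a symmetric idempotent \<open>T\<close>,
  \<open>|T v|^2 = v \<bullet> T v \<le> |v| |T v|\<close>; cancel one factor.\<close>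

lemma norm_Tproj_le: "norm (Tproj f x *v v) \<le> norm v"
proof -
  have "(Tproj f x *v v) \<bullet> (Tproj f x *v v) = v \<bullet> (transpose (Tproj f x) *v (Tproj f x *v v))"
    by (rule inner_transpose_matrix_vector[symmetric])
  also have "\<dots> = v \<bullet> (Tproj f x *v v)"
    unfolding transpose_Tproj matrix_vector_mul_assoc Tproj_idem ..
  also have "\<dots> \<le> norm v * norm (Tproj f x *v v)" by (rule norm_cauchy_schwarz)
  finally have "norm (Tproj f x *v v) * norm (Tproj f x *v v) \<le> norm v * norm (Tproj f x *v v)"
    by (simp add: power2_norm_eq_inner[symmetric] power2_eq_square)
  then show ?thesis by (cases "norm (Tproj f x *v v) = 0") (auto simp: mult_le_cancel_right)
qed

text \<open>A matrix of the form \<open>A^T - A\<close> is skew. Both the conservation of length and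
  the vanishing of one term of the divergence rest on this.\<close>

lemma skew_field: "v \<bullet> ((Npar' f x w - Nperp' f x w) *v v) = 0"
  using inner_transpose_matrix_vector[of v "Nperp' f x w" v]
  by (simp add: Npar'_def matrix_vector_mult_diff_rdistrib inner_diff_right inner_commute)

section \<open>Linearity in the direction, and parity in the velocity\<close>

lemma H_linear: "linear (\<lambda>w. H f x w u)"
  by (rule linearI) (auto simp: H_def vec_eq_iff inner_add_left)

lemma matrix_H_linear: "linear (\<lambda>w. matrix (H f x w))"
  by (rule linearI) (auto simp: matrix_def vec_eq_iff linear_add[OF H_linear] linear_scale[OF H_linear])

lemma Nperp'_linear: "linear (Nperp' f x)"
  unfolding Nperp'_def[abs_def]
  by (rule linearI)
    (simp_all add: linear_add[OF matrix_H_linear] linear_scale[OF matrix_H_linear]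
      bounded_bilinear.add_left[OF bounded_bilinear_matrix_mult]
      bounded_bilinear.add_right[OF bounded_bilinear_matrix_mult]
      bounded_bilinear.scaleR_left[OF bounded_bilinear_matrix_mult]
      bounded_bilinear.scaleR_right[OF bounded_bilinear_matrix_mult])

lemma Npar'_linear: "linear (Npar' f x)"
  unfolding Npar'_def[abs_def]
  by (rule linearI)
    (simp_all add: linear_add[OF Nperp'_linear] linear_scale[OF Nperp'_linear]
      linear_add[OF linear_transpose] linear_scale[OF linear_transpose])

text \<open>The position part is odd in \<open>v\<close>. The velocity part is quadratic in
  \<open>v\<close>, once through the direction and once through the vector acted on, hence even. The
  map applied on the right is minus the reversal \<open>(x, v) \<mapsto> (x, - v)\<close>.\<close>

lemma time_reversed_field:
  "ode_field f (x, - v) = (\<lambda>(x, v). (- x, v)) (ode_field f (x, v))"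
proof -
  have neg: "A *v (- v) = - (A *v v)" for A :: "real^'n^'n"
    by (rule linear_neg[OF matrix_vector_mul_linear])
  have neg': "(- A) *v v = - (A *v v)" for A :: "real^'n^'n"
    using bounded_bilinear.minus_left[OF bounded_bilinear_matrix_vector_mult] .
  show ?thesis
    unfolding ode_field_def Let_def prod.case neg linear_neg[OF Npar'_linear]
      linear_neg[OF Nperp'_linear] minus_diff_minus neg' by simp
qed

context
  assumes smooth: "smooth f"
begin

section \<open>Regularity of the Jacobian, the projections and the field\<close>

lemma Jac_entry: "Jac f x $ i $ k = frechet_derivative f (at x) (axis k 1) $ i"
  by (simp add: jacobian_def matrix_def)

lemma f_has_derivative: "(f has_derivative (\<lambda>u. Jac f x *v u)) (at x)"
  using C1_D(1)[OF smooth_imp_C1[OF smooth]] jacobian_works differentiableI by blast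

lemma C1_Jac: "C1 (Jac f)"
proof -
  have "C1 (\<lambda>x. \<chi> i k. frechet_derivative f (at x) (axis k 1) $ i)"
    by (intro C1_vec C1_nth smooth_imp_C1 smooth_frechet_derivative smooth)
  then show ?thesis by (simp add: Jac_entry[symmetric])
qed

lemma hessian_entry:
  "hessian (\<lambda>y. f y $ i) x $ j $ k = frechet_derivative (Jac f) (at x) (axis j 1) $ i $ k"
proof -
  have "frechet_derivative (\<lambda>y. f y $ i) (at y) (axis k 1) = Jac f y $ i $ k" for y
    by (simp add: frechet_derivative_nth smooth_imp_C1 smooth Jac_entry)
  moreover have "frechet_derivative (\<lambda>y. Jac f y $ i $ k) (at x) = (\<lambda>u. frechet_derivative (Jac f) (at x) u $ i $ k)"
    by (simp add: frechet_derivative_nth C1_Jac C1_nth)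
  ultimately show ?thesis by (simp add: hessian_def)
qed

text \<open>The first argument of \<open>H\<close> is paired with the outer derivative in
  \<open>hessian\<close>, so contracting with \<open>w\<close> is linearity of the derivative of
  \<open>Jac f\<close> in its direction.\<close>

lemma Jac_has_derivative: "(Jac f has_derivative (\<lambda>w. matrix (H f x w))) (at x)"
proof -
  let ?J' = "frechet_derivative (Jac f) (at x)"
  have lin: "linear ?J'" by (rule has_derivative_linear[OF C1_D(1)[OF C1_Jac]])
  have "matrix (H f x w) $ i $ k = ?J' w $ i $ k" for w i k
  proof -
    have "matrix (H f x w) $ i $ k = (\<Sum>j\<in>UNIV. w $ j * ?J' (axis j 1) $ i $ k)"
      by (simp add: matrix_def H_def inner_vec_def matrix_vector_mult_basis column_def hessian_entry)
    also have "\<dots> = ?J' (\<Sum>j\<in>UNIV. w $ j *\<^sub>R axis j 1) $ i $ k"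
      by (simp add: linear_sum[OF lin] linear_scale[OF lin])
    also have "(\<Sum>j\<in>UNIV. w $ j *\<^sub>R axis j 1) = w"
      using basis_expansion[of w] by (simp add: scalar_mult_eq_scaleR)
    finally show ?thesis .
  qed
  then have "(\<lambda>w. matrix (H f x w)) = ?J'" by (simp add: fun_eq_iff vec_eq_iff)
  then show ?thesis using C1_D(1)[OF C1_Jac] by simp
qed

text \<open>The Hessian entries are second derivatives of a smooth map. The base point
  \<open>p\<close> and the direction \<open>w\<close> are functions of \<open>z\<close> because in
  the field both depend on the phase space point.\<close>

lemma C1_matrix_H:
  fixes p w :: "'a::euclidean_space \<Rightarrow> real^'n"
  assumes "linear p" and "C1 w"
  shows "C1 (\<lambda>z. matrix (H f (p z) (w z)))"
proof -
  have h: "C1 (\<lambda>x. hessian (\<lambda>y. f y $ i) x)" for i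
  proof -
    have "hessian (\<lambda>y. f y $ i) x $ j $ k
        = frechet_derivative (\<lambda>y. frechet_derivative f (at y) (axis k 1)) (at x) (axis j 1) $ i" for x j k
      by (simp add: hessian_def frechet_derivative_nth smooth_imp_C1 smooth smooth_frechet_derivative)
    then have "hessian (\<lambda>y. f y $ i) = (\<lambda>x. \<chi> j k.
        frechet_derivative (\<lambda>y. frechet_derivative f (at y) (axis k 1)) (at x) (axis j 1) $ i)"
      by (simp add: fun_eq_iff vec_eq_iff)
    then show ?thesis
      by (simp only:) (intro C1_vec C1_nth smooth_imp_C1 smooth_frechet_derivative smooth)
  qed
  have "C1 (\<lambda>z. \<chi> i k. w z \<bullet> (hessian (\<lambda>y. f y $ i) (p z) *v axis k 1))"
    by (intro C1_vec C1_bilinear[OF bounded_bilinear_inner] assms(2) C1_matrix_vector_mult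
        C1_const C1_compose_linear[OF assms(1) h])
  then show ?thesis by (simp add: matrix_def H_def)
qed

lemma C1_Jplus: "C1 (Jplus f)"
  unfolding Jplus_def[abs_def]
  by (intro C1_matrix_mult C1_transpose C1_matrix_inv C1_Jac invertible_gram)

lemma C1_Nproj: "C1 (Nproj f)"
  unfolding Nproj_def[abs_def] by (intro C1_matrix_mult C1_Jplus C1_Jac)

lemma C1_Tproj: "C1 (Tproj f)"
  unfolding Tproj_def[abs_def] by (intro C1_diff C1_const C1_Nproj)

lemma C1_ode_field: "C1 (ode_field f)"
proof -
  have lin: "linear (fst :: (real^'n) \<times> (real^'n) \<Rightarrow> _)" "linear (snd :: (real^'n) \<times> (real^'n) \<Rightarrow> _)"
    by (auto intro: linear_fst linear_snd)
  note c = C1_compose_linear[OF lin(1)]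
  have w: "C1 (\<lambda>z. (Tproj f (fst z) - Nproj f (fst z)) *v snd z)"
    by (intro C1_matrix_vector_mult C1_diff c[OF C1_Tproj] c[OF C1_Nproj] C1_linear[OF lin(2)])
  have perp: "C1 (\<lambda>z. Nperp' f (fst z) ((Tproj f (fst z) - Nproj f (fst z)) *v snd z))"
    unfolding Nperp'_def
    by (intro C1_matrix_mult C1_matrix_H[OF lin(1)] w c[OF C1_Jplus] c[OF C1_Tproj])
  have "C1 (\<lambda>z. (Tproj f (fst z) *v snd z,
      (Npar' f (fst z) ((Tproj f (fst z) - Nproj f (fst z)) *v snd z)
       - Nperp' f (fst z) ((Tproj f (fst z) - Nproj f (fst z)) *v snd z)) *v snd z))"
    unfolding Npar'_def
    by (intro C1_Pair C1_matrix_vector_mult C1_diff C1_transpose perp c[OF C1_Tproj] C1_linear[OF lin(2)])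
  then show ?thesis by (simp add: ode_field_def Let_def case_prod_beta')
qed

text \<open>The formula of Golub and Pereyra: differentiating \<open>J N = J\<close> gives \<open>N N' = N'\<^sub>\<bottom>\<close>, and then
  \<open>N' = N' N + N N'\<close> with \<open>N' N = (N N')\<^sup>T\<close>.\<close>

lemma Nproj_has_derivative:
  "(Nproj f has_derivative (\<lambda>w. Nperp' f x w + Npar' f x w)) (at x)"
proof -
  let ?N' = "frechet_derivative (Nproj f) (at x)"
  note N' = C1_D(1)[OF C1_Nproj, of x]
  note mult = bounded_bilinear.FDERIV[OF bounded_bilinear_matrix_mult]
  have "((\<lambda>x. Jac f x ** Nproj f x) has_derivative
      (\<lambda>w. Jac f x ** ?N' w + matrix (H f x w) ** Nproj f x)) (at x)"
    by (rule mult[OF Jac_has_derivative N'])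
  then have "(\<lambda>w. Jac f x ** ?N' w + matrix (H f x w) ** Nproj f x) = (\<lambda>w. matrix (H f x w))"
    unfolding Jac_Nproj using Jac_has_derivative by (rule has_derivative_unique)
  then have JN': "Jac f x ** ?N' w = matrix (H f x w) ** Tproj f x" for w
    by (simp add: Tproj_def bounded_bilinear.diff_right[OF bounded_bilinear_matrix_mult] fun_eq_iff eq_diff_eq)
  have perp: "Nproj f x ** ?N' w = Nperp' f x w" for w
  proof -
    have "Nproj f x ** ?N' w = Jplus f x ** (Jac f x ** ?N' w)"
      unfolding Nproj_def by (rule matrix_mul_assoc[symmetric])
    then show ?thesis unfolding JN' Nperp'_def by (simp only: matrix_mul_assoc)
  qed
  have "((\<lambda>x. Nproj f x ** Nproj f x) has_derivative
      (\<lambda>w. Nproj f x ** ?N' w + ?N' w ** Nproj f x)) (at x)"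
    by (rule mult[OF N' N'])
  then have idem': "(\<lambda>w. Nproj f x ** ?N' w + ?N' w ** Nproj f x) = ?N'"
    unfolding Nproj_idem using N' by (rule has_derivative_unique)
  have "((\<lambda>x. transpose (Nproj f x)) has_derivative (\<lambda>w. transpose (?N' w))) (at x)"
    by (rule bounded_linear.has_derivative[OF linear_transpose[unfolded linear_conv_bounded_linear] N'])
  then have sym': "(\<lambda>w. transpose (?N' w)) = ?N'"
    unfolding transpose_Nproj using N' by (rule has_derivative_unique)
  have sym: "transpose (?N' w) = ?N' w" for w using fun_cong[OF sym', of w] .
  have par: "?N' w ** Nproj f x = Npar' f x w" for w
    unfolding Npar'_def perp[symmetric] matrix_transpose_mul sym transpose_Nproj ..
  show ?thesis using N' unfolding idem'[unfolded perp par, symmetric] .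
qed

section \<open>The divergence of the field\<close>

lemma divergence_ode_field: "divergence (ode_field f) (x, v) = 0"
proof -
  let ?F = "ode_field f" and ?T = "Tproj f x" and ?N = "Nproj f x" and ?J = "Jplus f x"
  let ?S = "?T - ?N" and ?h = "\<lambda>a u. matrix (H f x a) *v u"
  let ?F' = "frechet_derivative ?F (at (x, v))"
  note F' = C1_D(1)[OF C1_ode_field, of "(x, v)"]
  note mv = bounded_bilinear_matrix_vector_mult
  have Nperp_app: "Nperp' f x a *v u = ?J *v ?h a (?T *v u)" for a u
    unfolding Nperp'_def by (simp only: matrix_vector_mul_assoc matrix_mul_assoc)
  have Npar_inner: "b \<bullet> (Npar' f x a *v u) = (Nperp' f x a *v b) \<bullet> u" for a b u
    unfolding Npar'_def by (rule inner_transpose_matrix_vector)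

  \<comment> \<open>Freezing \<open>v\<close> identifies the position block of the derivative with
    that of \<open>Tproj f y *v v\<close>, to which the formula for the derivative of
    \<open>Nproj\<close> applies.\<close>
  have "((\<lambda>y. (y, v)) has_derivative (\<lambda>u. (u, 0))) (at x)"
    by (auto intro!: derivative_eq_intros)
  from has_derivative_fst[OF has_derivative_compose[OF this F']]
  have 1: "((\<lambda>y. Tproj f y *v v) has_derivative (\<lambda>u. fst (?F' (u, 0)))) (at x)"
    by (simp add: ode_field_def Let_def)
  have "((\<lambda>y. Tproj f y) has_derivative (\<lambda>u. 0 - (Nperp' f x u + Npar' f x u))) (at x)"
    unfolding Tproj_def by (rule has_derivative_diff[OF has_derivative_const Nproj_has_derivative])
  from bounded_bilinear.FDERIV[OF mv this has_derivative_const[of v]]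
  have "((\<lambda>y. Tproj f y *v v) has_derivative
      (\<lambda>u. - (Nperp' f x u *v v) - Npar' f x u *v v)) (at x)"
    by (simp add: bounded_bilinear.minus_left[OF mv] bounded_bilinear.diff_left[OF mv]
        bounded_bilinear.add_left[OF mv] bounded_bilinear.zero_right[OF mv])
  from fun_cong[OF has_derivative_unique[OF 1 this]]
  have fst': "fst (?F' (u, 0)) = - (Nperp' f x u *v v) - Npar' f x u *v v" for u .

  let ?A = "\<lambda>w. Npar' f x w - Nperp' f x w"
  have A_app: "?A w *v u = Npar' f x w *v u - Nperp' f x w *v u" for w u
    by (rule bounded_bilinear.diff_left[OF mv])
  have linA: "linear ?A" by (intro linear_compose_sub Npar'_linear Nperp'_linear)
  \<comment> \<open>With \<open>x\<close> frozen the acceleration is quadratic in the velocity, so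
    the product rule yields one term for each occurrence.\<close>
  have "((\<lambda>y. (x, y)) has_derivative (\<lambda>u. (0, u))) (at v)"
    by (auto intro!: derivative_eq_intros)
  from has_derivative_snd[OF has_derivative_compose[OF this F']]
  have 2: "((\<lambda>y. ?A (?S *v y) *v y) has_derivative (\<lambda>u. snd (?F' (0, u)))) (at v)"
    by (simp add: ode_field_def Let_def)
  have "((\<lambda>y. ?A (?S *v y)) has_derivative (\<lambda>u. ?A (?S *v u))) (at v)"
    using linear_compose[OF matrix_vector_mul_linear[of ?S] linA]
    by (intro bounded_linear_imp_has_derivative) (simp add: linear_conv_bounded_linear comp_def)
  from bounded_bilinear.FDERIV[OF mv this has_derivative_ident]
  have "((\<lambda>y. ?A (?S *v y) *v y) has_derivative
      (\<lambda>u. ?A (?S *v v) *v u + ?A (?S *v u) *v v)) (at v)" .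
  from fun_cong[OF has_derivative_unique[OF 2 this]]
  have snd': "snd (?F' (0, u)) = ?A (?S *v v) *v u + ?A (?S *v u) *v v" for u .

  have selfadj: "(?S *v a) \<bullet> b = a \<bullet> (?S *v b)" for a b
  proof -
    have "transpose ?S = ?S"
      by (simp add: linear_diff[OF linear_transpose] transpose_Nproj transpose_Tproj)
    then show ?thesis using inner_transpose_matrix_vector[of a ?S b] by simp
  qed
  have TS: "?T *v (?S *v u) = ?T *v u" for u
    by (simp add: matrix_vector_mul_assoc bounded_bilinear.diff_right[OF bounded_bilinear_matrix_mult]
        Tproj_idem Tproj_Nproj)
  have SJ: "?S *v (?J *v y) = - (?J *v y)" for y
    by (simp add: matrix_vector_mul_assoc bounded_bilinear.diff_left[OF bounded_bilinear_matrix_mult]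
        Tproj_Jplus Nproj_Jplus bounded_bilinear.minus_left[OF mv])
  have lin_h: "linear (\<lambda>a. ?h a u)" for u
    by (rule linearI) (simp_all add: linear_add[OF matrix_H_linear] linear_scale[OF matrix_H_linear]
        bounded_bilinear.add_left[OF mv] bounded_bilinear.scaleR_left[OF mv])
  have lin_M: "linear ((*v) M)" for M :: "real^'p^'q" by (rule matrix_vector_mul_linear)
  define \<alpha> where "\<alpha> = (\<Sum>b\<in>Basis. b \<bullet> (?J *v ?h b (?T *v v)))"
  define \<beta> where "\<beta> = (\<Sum>b\<in>Basis. (?J *v ?h b (?T *v b)) \<bullet> v)"
  \<comment> \<open>Moving \<open>?S\<close> to the other occurrence of \<open>b\<close> places it
    behind \<open>?T\<close>, which absorbs it.\<close>
  have \<beta>: "(\<Sum>b\<in>Basis. (?J *v ?h (?S *v b) (?T *v b)) \<bullet> v) = \<beta>"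
  proof -
    have "(\<Sum>b\<in>Basis. (?J *v ?h (?S *v b) (?T *v b)) \<bullet> v)
        = (\<Sum>b\<in>Basis. (?J *v ?h b (?T *v (?S *v b))) \<bullet> v)"
      by (rule sum_Basis_selfadjoint[OF _ _ selfadj, of "\<lambda>a b. (?J *v ?h a (?T *v b)) \<bullet> v"])
        (auto intro!: linearI simp: linear_add[OF lin_h] linear_scale[OF lin_h]
          linear_add[OF lin_M] linear_scale[OF lin_M] inner_add_left)
    then show ?thesis unfolding TS \<beta>_def .
  qed
  \<comment> \<open>Here \<open>?S\<close> moves onto the range of \<open>?J\<close>, where it acts
    as minus the identity. This sign makes \<open>\<alpha>\<close> cancel against the position part
    instead of doubling it.\<close>
  have \<alpha>: "(\<Sum>b\<in>Basis. b \<bullet> (?J *v ?h (?S *v b) (?T *v v))) = - \<alpha>"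
  proof -
    have "(\<Sum>b\<in>Basis. b \<bullet> (?J *v ?h (?S *v b) (?T *v v)))
        = (\<Sum>b\<in>Basis. (?S *v b) \<bullet> (?J *v ?h b (?T *v v)))"
      by (rule sum_Basis_selfadjoint[OF _ _ selfadj, of "\<lambda>a b. b \<bullet> (?J *v ?h a (?T *v v))"])
        (auto intro!: linearI simp: linear_add[OF lin_h] linear_scale[OF lin_h]
          linear_add[OF lin_M] linear_scale[OF lin_M] inner_add_left inner_add_right)
    then show ?thesis unfolding selfadj SJ \<alpha>_def by (simp add: sum_negf)
  qed
  have "divergence ?F (x, v) = (\<Sum>b\<in>Basis. b \<bullet> fst (?F' (b, 0))) + (\<Sum>b\<in>Basis. b \<bullet> snd (?F' (0, b)))"
  proof -
    have "inj_on (\<lambda>u. (u, 0 :: real^'n)) (Basis :: (real^'n) set)" "inj_on (\<lambda>u. (0 :: real^'n, u)) (Basis :: (real^'n) set)"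
      by (auto intro: inj_onI)
    moreover have "(\<lambda>u. (u, 0)) ` Basis \<inter> (\<lambda>u. (0, u)) ` (Basis :: (real^'n) set) = ({} :: ((real^'n) \<times> (real^'n)) set)"
      by auto
    ultimately show ?thesis
      unfolding divergence_def Basis_prod_def
      by (simp add: sum.union_disjoint sum.reindex inner_prod_def inner_commute)
  qed
  also have "(\<Sum>b\<in>Basis. b \<bullet> fst (?F' (b, 0))) = - \<alpha> - \<beta>"
    unfolding fst' inner_diff_right inner_minus_right Npar_inner Nperp_app
    by (simp add: sum_subtractf sum_negf \<alpha>_def \<beta>_def)
  \<comment> \<open>The term with fixed direction \<open>?S *v v\<close> drops out by skewness; only
    the variation of the direction remains.\<close>
  also have "(\<Sum>b\<in>Basis. b \<bullet> snd (?F' (0, b))) = \<beta> + \<alpha>"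
    unfolding snd' inner_add_right skew_field add_0_left
    unfolding A_app inner_diff_right Npar_inner Nperp_app sum_subtractf \<alpha> \<beta> by simp
  finally show ?thesis by simp
qed

section \<open>Conservation laws along solutions\<close>

text \<open>The direction \<open>w\<close> is hidden because the matrix acting on \<open>v\<close>
  is skew whatever \<open>w\<close> is.\<close>

lemma solution_components:
  assumes "solution (ode_field f) S (\<lambda>t. (x t, v t))" and "t \<in> S"
  shows "(x has_vector_derivative Tproj f (x t) *v v t) (at t within S)"
    and "\<exists>w. (v has_vector_derivative (Npar' f (x t) w - Nperp' f (x t) w) *v v t) (at t within S)"
proof -
  let ?F = "ode_field f (x t, v t)"
  have "((\<lambda>t. (x t, v t)) has_derivative (\<lambda>h. h *\<^sub>R ?F)) (at t within S)"
    using assms by (simp add: solution_def has_vector_derivative_def)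
  from has_derivative_fst[OF this] has_derivative_snd[OF this]
  have "(x has_vector_derivative fst ?F) (at t within S)" "(v has_vector_derivative snd ?F) (at t within S)"
    by (simp_all add: has_vector_derivative_def)
  then show "(x has_vector_derivative Tproj f (x t) *v v t) (at t within S)"
    and "\<exists>w. (v has_vector_derivative (Npar' f (x t) w - Nperp' f (x t) w) *v v t) (at t within S)"
    by (auto simp: ode_field_def Let_def)
qed

lemma norm_velocity_derivative:
  assumes "solution (ode_field f) S (\<lambda>t. (x t, v t))" and "t \<in> S"
  shows "((\<lambda>s. (norm (v s))\<^sup>2) has_real_derivative 0) (at t within S)"
proof -
  obtain w where "(v has_vector_derivative (Npar' f (x t) w - Nperp' f (x t) w) *v v t) (at t within S)"
    using solution_components(2)[OF assms] by blast
  from bounded_bilinear.has_vector_derivative[OF bounded_bilinear_inner this this] skew_field[of "v t" "x t" w]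
  show ?thesis
    by (simp add: power2_norm_eq_inner has_real_derivative_iff_has_vector_derivative inner_commute)
qed

lemma norm_velocity_constant:
  assumes sol: "solution (ode_field f) S (\<lambda>t. (x t, v t))" and st: "s \<in> S" "t \<in> S"
  shows "norm (v t) = norm (v s)"
proof -
  have "convex S" using sol by (simp add: solution_def is_interval_convex)
  then obtain c where "\<And>u. u \<in> S \<Longrightarrow> (norm (v u))\<^sup>2 = c"
    using has_derivative_zero_constant[of S "\<lambda>u. (norm (v u))\<^sup>2"] norm_velocity_derivative[OF sol]
    by (auto simp: has_real_derivative_iff_has_vector_derivative has_vector_derivative_def)
  then show ?thesis using st by (metis norm_ge_zero power2_eq_iff_nonneg)
qed

lemma constraint_derivative:
  assumes "solution (ode_field f) S (\<lambda>t. (x t, v t))" and "t \<in> S"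
  shows "((\<lambda>s. f (x s)) has_vector_derivative 0) (at t within S)"
proof -
  have "((\<lambda>s. f (x s)) has_derivative (\<lambda>h. Jac f (x t) *v (h *\<^sub>R (Tproj f (x t) *v v t)))) (at t within S)"
    using solution_components(1)[OF assms] f_has_derivative
    unfolding has_vector_derivative_def by (rule has_derivative_compose)
  moreover have "Jac f (x t) *v (h *\<^sub>R (Tproj f (x t) *v v t)) = 0" for h
    by (simp add: linear_scale[OF matrix_vector_mul_linear] matrix_vector_mul_assoc Jac_Tproj
        bounded_bilinear.zero_left[OF bounded_bilinear_matrix_vector_mult])
  ultimately show ?thesis by (simp add: has_vector_derivative_def)
qed

lemma constraint_constant:
  assumes sol: "solution (ode_field f) S (\<lambda>t. (x t, v t))" and st: "s \<in> S" "t \<in> S"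
  shows "f (x t) = f (x s)"
proof -
  have "convex S" using sol by (simp add: solution_def is_interval_convex)
  then obtain c where "\<And>u. u \<in> S \<Longrightarrow> f (x u) = c"
    using has_derivative_zero_constant[of S "\<lambda>u. f (x u)"] constraint_derivative[OF sol]
    by (auto simp: has_vector_derivative_def)
  then show ?thesis using st by simp
qed

section \<open>Confinement of trajectories and preservation of volume\<close>

text \<open>The speed \<open>|v|\<close> is constant, hence at most \<open>R\<close>, and
  \<open>|T v| \<le> |v|\<close>, so \<open>x\<close> travels at most
  \<open>\<bar>t\<bar> * R\<close>. This is the confinement that the Liouville theorem above asks
  for.\<close>

lemma solution_bound:
  assumes sol: "solution (ode_field f) (closed_segment 0 t) z" and R: "norm (z 0) \<le> R"
    and s: "s \<in> closed_segment 0 t"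
  shows "norm (z s) \<le> 2 * R + \<bar>t\<bar> * R"
proof -
  let ?I = "closed_segment 0 t"
  define x where "x s = fst (z s)" for s
  define v where "v s = snd (z s)" for s
  have z: "z = (\<lambda>s. (x s, v s))" by (simp add: x_def v_def)
  have sol': "solution (ode_field f) ?I (\<lambda>s. (x s, v s))" using sol unfolding z .
  have I0: "0 \<in> ?I" by simp
  have R0: "norm (x 0) \<le> R" "norm (v 0) \<le> R"
    using R norm_fst_le[of "fst (z 0)" "snd (z 0)"] norm_snd_le[of "snd (z 0)" "fst (z 0)"]
    by (simp_all add: x_def v_def)
  have v: "norm (v u) \<le> R" if "u \<in> ?I" for u
    using norm_velocity_constant[OF sol' I0 that] R0(2) by simp
  have "norm (x s - x 0) \<le> R * norm (s - 0)"
  proof (rule differentiable_bound[of ?I x "\<lambda>u h. h *\<^sub>R (Tproj f (x u) *v v u)"])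
    fix u assume u: "u \<in> ?I"
    show "(x has_derivative (\<lambda>h. h *\<^sub>R (Tproj f (x u) *v v u))) (at u within ?I)"
      using solution_components(1)[OF sol' u] by (simp add: has_vector_derivative_def)
    have "norm (Tproj f (x u) *v v u) \<le> R" using norm_Tproj_le[of "x u" "v u"] v[OF u] by simp
    then show "onorm (\<lambda>h. h *\<^sub>R (Tproj f (x u) *v v u)) \<le> R"
      by (intro onorm_le) (simp add: mult.commute[of R] mult_left_mono)
  qed (use s in auto)
  also have "R * norm (s - 0) \<le> R * \<bar>t\<bar>"
    using s order_trans[OF norm_ge_zero R0(1)]
    by (intro mult_left_mono) (auto simp: closed_segment_eq_real_ivl split: if_splits)
  finally have "norm (x s - x 0) \<le> R * \<bar>t\<bar>" .
  moreover have "norm (x s) \<le> norm (x s - x 0) + norm (x 0)"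
    using norm_triangle_ineq[of "x s - x 0" "x 0"] by simp
  moreover have "norm (z s) \<le> norm (x s) + norm (v s)"
    unfolding z by (rule norm_Pair_le)
  ultimately show ?thesis using R0(1) v[OF s] by (simp add: mult.commute)
qed

text \<open>The type \<open>'n bit0\<close> has twice as many elements as \<open>'n\<close>,
  matching the dimension of phase space, and it is well-ordered.\<close>

lemma flow_preserves_lebesgue_ode_field: "flow_preserves_lebesgue (ode_field f)"
proof (rule divergence_free_imp_flow_preserves_lebesgue
    [where F' = "\<lambda>x. frechet_derivative (ode_field f) (at x)" and 'k = "'n bit0"])
  show "CARD('n bit0) = DIM((real^'n) \<times> (real^'n))" by simp
  show "(ode_field f has_derivative frechet_derivative (ode_field f) (at x)) (at x)" for x
    by (rule C1_D(1)[OF C1_ode_field])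
  show "continuous_on UNIV (\<lambda>x. frechet_derivative (ode_field f) (at x) b)" for b
    by (rule C1_D(2)[OF C1_ode_field])
  show "(\<Sum>b\<in>Basis. frechet_derivative (ode_field f) (at z) b \<bullet> b) = 0" for z
    using divergence_ode_field[of "fst z" "snd z"] by (simp add: divergence_def)
  show "\<exists>R'. \<forall>z. solution (ode_field f) (closed_segment 0 t) z \<and> norm (z 0) \<le> R \<longrightarrow>
      (\<forall>s\<in>closed_segment 0 t. norm (z s) \<le> R')" for t R
    using solution_bound by blast
qed

lemma divergence_free_ode_field: "divergence_free (ode_field f)"
  unfolding divergence_free_def
  using C1_ode_field divergence_ode_field by (auto simp: C1_def)

end

section \<open>Time reversal\<close>

text \<open>The inner \<open>- t\<close> contributes a factor \<open>-1\<close> to the derivative,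
  and negating the velocity then turns minus the field into the field at the reflected
  point.\<close>

lemma solution_reversed:
  assumes sol: "solution (ode_field f) S z"
  shows "solution (ode_field f) (uminus ` S) (\<lambda>t. (\<lambda>(x, v). (x, - v)) (z (- t)))"
  unfolding solution_def
proof (intro conjI ballI)
  let ?R = "\<lambda>(x, v). (x, - v) :: (real^'n) \<times> (real^'n)"
  show "is_interval (uminus ` S)"
    using sol by (simp add: solution_def is_interval_neg_translationI)
  fix t assume t: "t \<in> uminus ` S"
  have "bounded_linear ?R"
    by (simp add: linear_conv_bounded_linear[symmetric]) (auto intro!: linearI)
  moreover have "((\<lambda>t. z (- t)) has_vector_derivative - ode_field f (z (- t))) (at t within uminus ` S)"
  proof -
    have "((\<lambda>t::real. - t) has_vector_derivative - 1) (at t within uminus ` S)"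
      by (auto intro!: derivative_eq_intros)
    moreover have "(z has_vector_derivative ode_field f (z (- t))) (at (- t) within uminus ` uminus ` S)"
      using sol t by (auto simp: solution_def image_image)
    ultimately show ?thesis
      using vector_diff_chain_within[of uminus "- 1" t "uminus ` S" z] by (simp add: comp_def)
  qed
  ultimately have "((\<lambda>t. ?R (z (- t))) has_vector_derivative ?R (- ode_field f (z (- t)))) (at t within uminus ` S)"
    by (rule bounded_linear.has_vector_derivative)
  moreover have "?R (- ode_field f (z (- t))) = ode_field f (?R (z (- t)))"
    using time_reversed_field[of "fst (z (- t))" "snd (z (- t))"] by (simp add: case_prod_beta')
  ultimately show "((\<lambda>t. ?R (z (- t))) has_vector_derivative ode_field f (?R (z (- t)))) (at t within uminus ` S)"
    by simp
qed

lemma time_reversible_ode_field: "time_reversible (\<lambda>(x, v). (x, - v)) (ode_field f)"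
  unfolding time_reversible_def
proof (intro allI iffI)
  \<comment> \<open>Reversal is an involution, so applying it a second time gives the
    converse.\<close>
  fix S z assume "solution (ode_field f) (uminus ` S) (\<lambda>t. (\<lambda>(x, v). (x, - v)) (z (- t)))"
  from solution_reversed[OF this] show "solution (ode_field f) S z"
    by (simp add: image_image case_prod_beta')
qed (rule solution_reversed)

end

theorem theorem3:
  fixes f :: "real^'n \<Rightarrow> real^'m"
  assumes "2 \<le> CARD('n)"
    and "0 < CARD('m)" and "CARD('m) < CARD('n)"
    and "smooth f"
    and "\<And>x. rank (Jac f x) = CARD('m)"
  shows
    "(flow_preserves_lebesgue (ode_field f) \<and> divergence_free (ode_field f)) \<and>
     time_reversible (\<lambda>(x, v). (x, - v)) (ode_field f) \<and>
     (\<forall>S x v. solution (ode_field f) S (\<lambda>t. (x t, v t)) \<longrightarrow>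
        (\<forall>t\<in>S. ((\<lambda>s. (norm (v s))\<^sup>2) has_real_derivative 0) (at t within S)) \<and>
        (\<forall>s\<in>S. \<forall>t\<in>S. norm (v t) = norm (v s))) \<and>
     (\<forall>S x v. solution (ode_field f) S (\<lambda>t. (x t, v t)) \<longrightarrow>
        (\<forall>t\<in>S. ((\<lambda>s. f (x s)) has_vector_derivative 0) (at t within S)) \<and>
        (0 \<in> S \<longrightarrow> (\<forall>t\<in>S. x t \<in> {y. f y = f (x 0)})))"
  using flow_preserves_lebesgue_ode_field[OF assms(5,4)] divergence_free_ode_field[OF assms(5,4)]
    time_reversible_ode_field[OF assms(5)]
    norm_velocity_derivative[OF assms(5,4)] norm_velocity_constant[OF assms(5,4)]
    constraint_derivative[OF assms(5,4)] constraint_constant[OF assms(5,4)]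
  by (intro conjI allI impI ballI CollectI) blast+

end
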